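(* Let $X$ be a reflexive (real) Banach space and $T(t)$ be a $C_0$ semigroup on it with generator $A$. Let $\mathcal{N}$ be a Hilbert space and $C:X\to\mathcal{N}$ be a bounded operator such that the pair $(C,A)$ is detectable in $L^2$. Then the following conditions are equivalent: (i) the equation $\overline{A^*P+PA}=-C^*C$ has a positive definite solution $P\in\mathcal{L}_s^+(X,X^* )$ such that $P(\mathcal{D}_A)\subseteq\mathcal{D}_{A^*}$ (the bar stands for the unique bounded extension from $\mathcal{D}_A$ to $X$); (ii) $T(t)$ is exponentially stable, i.e. $\|T(t)\|\le Me^{-\varepsilon t}$ for all $t\ge0$ with some $M,\varepsilon>0$; (iii) the Lyapunov generator $\mathcal{A}P:=\overline{A^*P+PA}$ has a bounded inverse on $\mathcal{L}_s(X,X^* )$ and $-\mathcal{A}^{-1}\ge0$.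
   Context: $\mathcal{L}(X,X^* )$ is the space of bounded linear operators from $X$ to its dual $X^*$, with the operator norm. As $X$ is reflexive, $X^{**}$ is identified with $X$, so the adjoint $P^*$ of $P\in\mathcal{L}(X,X^* )$ is again in $\mathcal{L}(X,X^* )$. $P$ is symmetric if $P=P^*$, and positive definite if $\langle Px,x\rangle\ge0$ for all $x\in X$ (so "positive definite" means nonnegative). $\mathcal{L}_s(X,X^* )$ is the space of symmetric operators and $\mathcal{L}_s^+(X,X^* )$ the cone of positive definite symmetric operators. $-\mathcal{A}^{-1}\ge0$ means $-\mathcal{A}^{-1}$ maps $\mathcal{L}_s^+(X,X^* )$ into itself. $\mathcal{D}_A$ is the domain of $A$, $A^*$ is the Banach space adjoint of $A$ on $X^*$ with domain $\mathcal{D}_{A^*}$, and $C^*:\mathcal{N}\to X^*$ is the adjoint of $C$ with $\mathcal{N}$ identified with its dual. The Lyapunov semigroup of $T(t)$ is $\mathcal{T}(t)P:=T^*(t)PT(t)$ on $\mathcal{L}_s(X,X^* )$. Its generator (the Lyapunov generator) $\mathcal{A}$ has domain $\mathcal{D}_{\mathcal{A}}=\{P\in\mathcal{L}_s(X,X^* )\mid P\mathcal{D}_A\subseteq\mathcal{D}_{A^*},\ \|A^*P+PA\|<\infty\}$ (the norm being that of the operator $A^*P+PA$ defined on $\mathcal{D}_A\subseteq X$) and acts by $\mathcal{A}P=\overline{A^*P+PA}$. $(C,A)$ is detectable in $L^2$ if for all $x\in X$: $\int_0^\infty\|CT(t)x\|^2\,dt<\infty$ implies $\int_0^\infty\|T(t)x\|^2\,dt<\infty$.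 *)

theory Defs
  imports "HOL-Analysis.Analysis"
begin

section \<open>Duality\<close>

type_synonym 'a dual = "'a \<Rightarrow>\<^sub>L real"

lift_definition bidual_embedding :: "'a::real_normed_vector \<Rightarrow>\<^sub>L 'a dual dual"
  is "blinfun.prod_left"
  by (rule blinfun.bounded_linear_prod_left)

lemma bidual_embedding_apply [simp]:
  "blinfun_apply (blinfun_apply bidual_embedding x) f = blinfun_apply f x"
  by (simp add: bidual_embedding.rep_eq)

definition reflexive_space :: "'a::real_normed_vector itself \<Rightarrow> bool" where
  "reflexive_space _ \<longleftrightarrow> surj (blinfun_apply (bidual_embedding :: 'a \<Rightarrow>\<^sub>L 'a dual dual))"

lift_definition dual_adjoint ::
    "('a::real_normed_vector \<Rightarrow>\<^sub>L 'b::real_normed_vector) \<Rightarrow> 'b dual \<Rightarrow>\<^sub>L 'a dual"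
  is "\<lambda>S f. f o\<^sub>L S"
  by (rule bounded_bilinear.bounded_linear_left[OF bounded_bilinear_blinfun_compose])

lemma dual_adjoint_apply [simp]:
  "blinfun_apply (blinfun_apply (dual_adjoint S) f) x = blinfun_apply f (blinfun_apply S x)"
  by (simp add: dual_adjoint.rep_eq)

text \<open>The adjoint \<open>P\<^sup>*\<close> of \<open>P : X \<rightarrow> X\<^sup>*\<close> is a map \<open>X\<^sup>*\<^sup>* \<rightarrow> X\<^sup>*\<close>; it is read as a
  map \<open>X \<rightarrow> X\<^sup>*\<close> through the canonical embedding (onto when \<open>X\<close> is reflexive).\<close>

definition form_adjoint ::
    "('a::real_normed_vector \<Rightarrow>\<^sub>L 'a dual) \<Rightarrow> 'a \<Rightarrow>\<^sub>L 'a dual" where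
  "form_adjoint P = dual_adjoint P o\<^sub>L bidual_embedding"

lemma form_adjoint_apply:
  "blinfun_apply (blinfun_apply (form_adjoint P) x) y
     = blinfun_apply (blinfun_apply P y) x"
  by (simp add: form_adjoint_def)

definition sym_ops :: "('a::real_normed_vector \<Rightarrow>\<^sub>L 'a dual) set" where
  "sym_ops = {P. P = form_adjoint P}"

text \<open>Positive definite means nonnegative: no strictness for \<open>x \<noteq> 0\<close>.\<close>

definition pos_sym_ops :: "('a::real_normed_vector \<Rightarrow>\<^sub>L 'a dual) set" where
  "pos_sym_ops = {P \<in> sym_ops. \<forall>x. blinfun_apply (blinfun_apply P x) x \<ge> 0}"

text \<open>\<open>C\<^sup>*\<close> for an operator into a Hilbert space, which is identified with its dual by
  \<open>n \<mapsto> n \<bullet> _\<close>.\<close>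

lift_definition riesz_embedding :: "'n::real_inner \<Rightarrow>\<^sub>L 'n dual"
  is blinfun_inner_right
  by (rule bounded_linear_blinfun_inner_right)

definition hilbert_adjoint ::
    "('a::real_normed_vector \<Rightarrow>\<^sub>L 'n::real_inner) \<Rightarrow> 'n \<Rightarrow>\<^sub>L 'a dual" where
  "hilbert_adjoint C = dual_adjoint C o\<^sub>L riesz_embedding"

lemma hilbert_adjoint_apply:
  "blinfun_apply (blinfun_apply (hilbert_adjoint C) n) x = n \<bullet> blinfun_apply C x"
  by (simp add: hilbert_adjoint_def riesz_embedding.rep_eq)

section \<open>Operators with a domain\<close>

text \<open>An operator with domain \<open>D\<close> is a total function whose values outside \<open>D\<close> are ignored.
  The definite descriptions in \<open>adj_op\<close> and \<open>bounded_extension\<close> are meaningful for dense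
  \<open>D\<close>, which makes the described object unique, and when that object exists.\<close>

definition adj_dom :: "'a::real_normed_vector set \<Rightarrow> ('a \<Rightarrow> 'a) \<Rightarrow> 'a dual set" where
  "adj_dom D A = {f. \<exists>g::'a dual. \<forall>x\<in>D. blinfun_apply g x = blinfun_apply f (A x)}"

definition adj_op ::
    "'a::real_normed_vector set \<Rightarrow> ('a \<Rightarrow> 'a) \<Rightarrow> 'a dual \<Rightarrow> 'a dual" where
  "adj_op D A f = (THE g. \<forall>x\<in>D. blinfun_apply g x = blinfun_apply f (A x))"

text \<open>As in \<open>onorm\<close>, \<open>x = 0\<close> contributes \<open>0 / 0 = 0\<close>; the supremum is taken in
  \<open>ennreal\<close> so that an unbounded operator has norm \<open>\<infinity>\<close>.\<close>

definition norm_on ::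
    "'a::real_normed_vector set \<Rightarrow> ('a \<Rightarrow> 'b::real_normed_vector) \<Rightarrow> ennreal" where
  "norm_on D F = (SUP x\<in>D. ennreal (norm (F x) / norm x))"

definition bounded_extension ::
    "'a::real_normed_vector set \<Rightarrow> ('a \<Rightarrow> 'b::real_normed_vector) \<Rightarrow> 'a \<Rightarrow>\<^sub>L 'b" where
  "bounded_extension D F = (THE B. \<forall>x\<in>D. blinfun_apply B x = F x)"

text \<open>An operator \<open>F : D \<rightarrow> Y\<close>, with \<open>D\<close> a subset of the normed space \<open>Y\<close>, is a bijection
  onto \<open>Y\<close> whose inverse is bounded.\<close>

definition has_bounded_inverse_on ::
    "'b::real_normed_vector set \<Rightarrow> 'b set \<Rightarrow> ('b \<Rightarrow> 'b) \<Rightarrow> bool" where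
  "has_bounded_inverse_on Y D F \<longleftrightarrow>
     bij_betw F D Y \<and> (\<exists>K. \<forall>y\<in>Y. norm (inv_into D F y) \<le> K * norm y)"

section \<open>Semigroups\<close>

definition C0_semigroup :: "(real \<Rightarrow> 'a::real_normed_vector \<Rightarrow>\<^sub>L 'a) \<Rightarrow> bool" where
  "C0_semigroup T \<longleftrightarrow>
     T 0 = id_blinfun \<and>
     (\<forall>s\<ge>0. \<forall>t\<ge>0. T (s + t) = T s o\<^sub>L T t) \<and>
     (\<forall>x. ((\<lambda>t. blinfun_apply (T t) x) \<longlongrightarrow> x) (at_right 0))"

definition gen_dom :: "(real \<Rightarrow> 'a::real_normed_vector \<Rightarrow>\<^sub>L 'a) \<Rightarrow> 'a set" where
  "gen_dom T =
     {x. \<exists>y. ((\<lambda>h. (blinfun_apply (T h) x - x) /\<^sub>R h) \<longlongrightarrow> y) (at_right 0)}"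

definition gen :: "(real \<Rightarrow> 'a::real_normed_vector \<Rightarrow>\<^sub>L 'a) \<Rightarrow> 'a \<Rightarrow> 'a" where
  "gen T x = Lim (at_right 0) (\<lambda>h. (blinfun_apply (T h) x - x) /\<^sub>R h)"

definition exponentially_stable ::
    "(real \<Rightarrow> 'a::real_normed_vector \<Rightarrow>\<^sub>L 'a) \<Rightarrow> bool" where
  "exponentially_stable T \<longleftrightarrow>
     (\<exists>M>0. \<exists>\<epsilon>>0. \<forall>t\<ge>0. norm (T t) \<le> M * exp (- \<epsilon> * t))"

definition detectable_L2 ::
    "('a::real_normed_vector \<Rightarrow>\<^sub>L 'n::real_normed_vector) \<Rightarrow>
     (real \<Rightarrow> 'a \<Rightarrow>\<^sub>L 'a) \<Rightarrow> bool" where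
  "detectable_L2 C T \<longleftrightarrow>
     (\<forall>x. (\<integral>\<^sup>+t\<in>{0..}. ennreal ((norm (blinfun_apply C (blinfun_apply (T t) x)))\<^sup>2) \<partial>lborel) < \<infinity>
        \<longrightarrow> (\<integral>\<^sup>+t\<in>{0..}. ennreal ((norm (blinfun_apply (T t) x))\<^sup>2) \<partial>lborel) < \<infinity>)"

section \<open>The Lyapunov generator\<close>

abbreviation gen_adj_dom :: "(real \<Rightarrow> 'a::real_normed_vector \<Rightarrow>\<^sub>L 'a) \<Rightarrow> 'a dual set" where
  "gen_adj_dom T \<equiv> adj_dom (gen_dom T) (gen T)"

abbreviation gen_adj ::
    "(real \<Rightarrow> 'a::real_normed_vector \<Rightarrow>\<^sub>L 'a) \<Rightarrow> 'a dual \<Rightarrow> 'a dual" where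
  "gen_adj T \<equiv> adj_op (gen_dom T) (gen T)"

text \<open>\<open>A\<^sup>*P + PA\<close>, an operator with domain \<open>gen_dom T\<close>.\<close>

definition lyapunov_expr ::
    "(real \<Rightarrow> 'a::real_normed_vector \<Rightarrow>\<^sub>L 'a) \<Rightarrow> ('a \<Rightarrow>\<^sub>L 'a dual) \<Rightarrow> 'a \<Rightarrow> 'a dual" where
  "lyapunov_expr T P x = gen_adj T (blinfun_apply P x) + blinfun_apply P (gen T x)"

definition lyapunov_dom ::
    "(real \<Rightarrow> 'a::real_normed_vector \<Rightarrow>\<^sub>L 'a) \<Rightarrow> ('a \<Rightarrow>\<^sub>L 'a dual) set" where
  "lyapunov_dom T =
     {P \<in> sym_ops. blinfun_apply P ` gen_dom T \<subseteq> gen_adj_dom T \<and>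
        norm_on (gen_dom T) (lyapunov_expr T P) < \<infinity>}"

definition lyapunov_gen ::
    "(real \<Rightarrow> 'a::real_normed_vector \<Rightarrow>\<^sub>L 'a) \<Rightarrow> ('a \<Rightarrow>\<^sub>L 'a dual) \<Rightarrow> 'a \<Rightarrow>\<^sub>L 'a dual" where
  "lyapunov_gen T P = bounded_extension (gen_dom T) (lyapunov_expr T P)"

abbreviation lyapunov_inv ::
    "(real \<Rightarrow> 'a::real_normed_vector \<Rightarrow>\<^sub>L 'a) \<Rightarrow> ('a \<Rightarrow>\<^sub>L 'a dual) \<Rightarrow> 'a \<Rightarrow>\<^sub>L 'a dual" where
  "lyapunov_inv T \<equiv> inv_into (lyapunov_dom T) (lyapunov_gen T)"

end

theory Submission
  imports Defs
begin

text \<open>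
  Detectability is what makes the two solvability conditions sufficient. If \<open>P \<ge> 0\<close> solves the
  Lyapunov equation with right-hand side \<open>- C\<^sup>*C\<close>, then \<open>\<langle>P T(t)x, T(t)x\<rangle>\<close> decreases at rate
  \<open>\<parallel>C T(t)x\<parallel>\<^sup>2\<close>, so the output of every trajectory is square integrable; by detectability every
  trajectory is square integrable, and Datko's theorem yields exponential stability. Conversely,
  for a stable semigroup the inverse of the Lyapunov generator is minus the Gramian
  \<open>Q \<mapsto> \<integral> T\<^sup>*(t) Q T(t) dt\<close>, which is bounded and preserves nonnegativity. Finally, if
  \<open>- \<A>\<^sup>-\<^sup>1 \<ge> 0\<close> exists, then \<open>- \<A>\<^sup>-\<^sup>1(C\<^sup>*C)\<close> is a nonnegative solution of the equation.
\<close>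

section \<open>Baire category and dense subspaces\<close>

text \<open>If every \<open>E n\<close> had empty interior, Baire's theorem would give the union
  empty interior, yet the union is the whole space.\<close>

lemma Baire_closed_cover:
  fixes E :: "nat \<Rightarrow> 'a::banach set"
  assumes "\<And>n. closed (E n)" and "(\<Union>n. E n) = UNIV"
  obtains n x r where "r > 0" and "ball x r \<subseteq> E n"
proof -
  have "\<exists>n. interior (E n) \<noteq> {}"
  proof (rule ccontr)
    assume *: "\<nexists>n. interior (E n) \<noteq> {}"
    have "euclidean interior_of \<Union>(range E) = {}"
      using assms(1) * by (intro Baire_category_alt) (auto simp: completely_metrizable_space_euclidean)
    with assms(2) show False by simp
  qed
  then obtain n x where "x \<in> interior (E n)" by blast
  with that show thesis by (auto simp: mem_interior)
qed

text \<open>A uniform boundedness principle. Some sublevel set contains a ball around a point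
  \<open>x0\<close>, and \<open>diff\<close> moves that ball to the origin because
  \<open>x = (x0 + x) - x0\<close>. It serves both for suprema of orbit norms (\<open>c = 1\<close>)
  and for square integrals along orbits (\<open>c = 2\<close>).\<close>

lemma uniform_bound_ennreal:
  fixes p :: "'a::banach \<Rightarrow> ennreal" and c :: real
  assumes closed: "\<And>b::nat. closed {x. p x \<le> of_nat b}"
    and finite: "\<And>x. p x < \<infinity>"
    and diff: "\<And>x y. p (x - y) \<le> ennreal c * (p x + p y)"
  shows "\<exists>r>0. \<exists>B. \<forall>x. norm x \<le> r \<longrightarrow> p x \<le> ennreal B"
proof -
  have "(\<Union>b::nat. {x. p x \<le> of_nat b}) = UNIV"
    using finite ennreal_Ex_less_of_nat less_imp_le by (fastforce simp: infinity_ennreal_def)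
  then obtain b x0 r where r: "r > 0" "ball x0 r \<subseteq> {x. p x \<le> of_nat b}"
    using Baire_closed_cover[of "\<lambda>b::nat. {x. p x \<le> of_nat b}"] closed by metis
  have "p x \<le> ennreal (c * (2 * real b))" if "norm x \<le> r / 2" for x
  proof -
    have "x0 \<in> ball x0 r" "x0 + x \<in> ball x0 r"
      using that r(1) by (auto simp: dist_norm)
    then have "p x0 + p (x0 + x) \<le> of_nat b + of_nat b"
      using r(2) by (intro add_mono) blast+
    moreover have "p x \<le> ennreal c * (p (x0 + x) + p x0)"
      using diff[of "x0 + x" x0] by simp
    ultimately have "p x \<le> ennreal c * (of_nat b + of_nat b)"
      by (metis add.commute mult_left_mono order_trans zero_le)
    also have "of_nat b + of_nat b = ennreal (2 * real b)"
      by (simp add: ennreal_of_nat_eq_real_of_nat flip: ennreal_plus)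
    finally show ?thesis
      by (simp add: ennreal_mult'')
  qed
  with r(1) show ?thesis by (intro exI[of _ "r / 2"]) auto
qed

lemma norm_blinfun_le_cball:
  fixes f :: "'b::real_normed_vector \<Rightarrow>\<^sub>L 'c::real_normed_vector"
  assumes "r > 0" and "\<And>x. norm x \<le> r \<Longrightarrow> norm (f x) \<le> b"
  shows "norm f \<le> b / r"
proof (rule norm_blinfun_bound)
  have "0 \<le> b" using assms(2)[of 0] assms(1) by simp
  with assms(1) show "0 \<le> b / r" by simp
  fix x
  show "norm (f x) \<le> b / r * norm x"
  proof (cases "x = 0")
    case False
    with assms(1) assms(2)[of "(r / norm x) *\<^sub>R x"] show ?thesis
      by (simp add: blinfun.scaleR_right field_simps)
  qed simp
qed

lemma blinfun_eq_on_dense: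
  fixes f g :: "'a::real_normed_vector \<Rightarrow>\<^sub>L 'b::real_normed_vector"
  assumes "closure D = UNIV" and "\<And>x. x \<in> D \<Longrightarrow> blinfun_apply f x = blinfun_apply g x"
  shows "f = g"
proof -
  have "closed {x. blinfun_apply f x = blinfun_apply g x}"
    by (intro closed_Collect_eq continuous_intros)
  then have "closure D \<subseteq> {x. blinfun_apply f x = blinfun_apply g x}"
    using assms(2) by (intro closure_minimal) auto
  with assms(1) show ?thesis by (auto intro: blinfun_eqI)
qed

text \<open>The map is Lipschitz on \<open>D\<close>, hence extends continuously to the closure;
  linearity and the bound are closed conditions that hold on a dense set.\<close>

lemma blinfun_extend_dense:
  fixes f :: "'a::real_normed_vector \<Rightarrow> 'b::banach"
  assumes D: "subspace D" "closure D = UNIV"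
    and add: "\<And>x y. x \<in> D \<Longrightarrow> y \<in> D \<Longrightarrow> f (x + y) = f x + f y"
    and scale: "\<And>a x. x \<in> D \<Longrightarrow> f (a *\<^sub>R x) = a *\<^sub>R f x"
    and bound: "\<And>x. x \<in> D \<Longrightarrow> norm (f x) \<le> K * norm x"
  shows "\<exists>F. \<forall>x\<in>D. blinfun_apply F x = f x"
proof -
  have diff: "f x - f y = f (x - y)" if "x \<in> D" "y \<in> D" for x y
    using add[of "x - y" y] that D(1) by (simp add: subspace_diff)
  have "lipschitz_on \<bar>K\<bar> D f"
  proof (rule lipschitz_onI)
    fix x y assume xy: "x \<in> D" "y \<in> D"
    have "dist (f x) (f y) = norm (f (x - y))"
      using diff xy by (simp add: dist_norm)
    also have "\<dots> \<le> K * norm (x - y)"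
      using bound xy D(1) by (simp add: subspace_diff)
    also have "\<dots> \<le> \<bar>K\<bar> * dist x y"
      by (simp add: dist_norm mult_right_mono)
    finally show "dist (f x) (f y) \<le> \<bar>K\<bar> * dist x y" .
  qed auto
  then have "uniformly_continuous_on D f"
    by (rule lipschitz_on_uniformly_continuous)
  then obtain g where g: "uniformly_continuous_on (closure D) g" "\<And>x. x \<in> D \<Longrightarrow> f x = g x"
    using uniformly_continuous_on_extension_on_closure by metis
  have cont: "continuous_on UNIV g"
    using g(1) D(2) by (simp add: uniformly_continuous_imp_continuous)
  have dense: "P x" if "closed {x. P x}" "\<And>x. x \<in> D \<Longrightarrow> P x" for P :: "'a \<Rightarrow> bool" and x
    using closure_minimal[of D "{x. P x}"] that D(2) by auto
  have contc: "continuous_on UNIV (\<lambda>x. g (h x))" if "continuous_on UNIV h" for h :: "'a \<Rightarrow> 'a"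
    using continuous_on_compose2[OF cont that] by simp
  \<comment> \<open>Additivity is extended one variable at a time: first \<open>x\<close> leaves
    \<open>D\<close>, then \<open>y\<close>.\<close>
  have g_add_D: "\<forall>y\<in>D. g (x + y) = g x + g y" for x
  proof (rule dense[of _ x])
    show "closed {x. \<forall>y\<in>D. g (x + y) = g x + g y}"
      unfolding Ball_def
      by (intro closed_Collect_all closed_Collect_imp closed_Collect_eq continuous_intros contc cont) auto
  qed (use add D(1) in \<open>simp add: subspace_add flip: g(2)\<close>)
  have g_add: "g (x + y) = g x + g y" for x y
  proof (rule dense[of _ y])
    show "closed {y. g (x + y) = g x + g y}"
      by (intro closed_Collect_eq continuous_intros contc cont)
  qed (use g_add_D in blast)
  have g_scale: "g (a *\<^sub>R x) = a *\<^sub>R g x" for a x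
  proof (rule dense[of _ x])
    show "closed {x. g (a *\<^sub>R x) = a *\<^sub>R g x}"
      by (intro closed_Collect_eq continuous_intros contc cont)
  qed (use scale D(1) in \<open>simp add: subspace_scale flip: g(2)\<close>)
  have g_bound: "norm (g x) \<le> norm x * K" for x
  proof (rule dense[of _ x])
    show "closed {x. norm (g x) \<le> norm x * K}"
      by (intro closed_Collect_le continuous_intros contc cont)
  qed (use bound in \<open>simp add: mult.commute flip: g(2)\<close>)
  have "bounded_linear g"
    by (rule bounded_linear_intro[OF g_add g_scale g_bound])
  then show ?thesis
    using g(2) by (intro exI[of _ "Blinfun g"]) (simp add: bounded_linear_Blinfun_apply)
qed

text \<open>The fundamental theorem of calculus at the left endpoint, in the difference-quotient
  form that matches the definition of the generator.\<close>

lemma integral_mean_tendsto: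
  fixes f :: "real \<Rightarrow> 'b::banach"
  assumes "continuous_on {a..} f"
  shows "((\<lambda>h. integral {a..a + h} f /\<^sub>R h) \<longlongrightarrow> f a) (at_right 0)"
proof -
  have "((\<lambda>u. integral {a..u} f) has_vector_derivative f a) (at a within {a..a + 1})"
    by (intro integral_has_vector_derivative continuous_on_subset[OF assms]) auto
  then have "((\<lambda>u. integral {a..u} f) has_vector_derivative f a) (at_right a)"
    by (simp add: has_vector_derivative_def has_derivative_def at_within_Icc_at_right)
  then have "((\<lambda>u. norm (integral {a..u} f - (u - a) *\<^sub>R f a) / \<bar>u - a\<bar>) \<longlongrightarrow> 0) (at_right a)"
    by (simp add: has_vector_derivative_def has_derivative_iff_norm)
  moreover have "\<forall>\<^sub>F u in at_right a. norm (integral {a..u} f /\<^sub>R (u - a) - f a)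
      \<le> norm (integral {a..u} f - (u - a) *\<^sub>R f a) / \<bar>u - a\<bar>"
    using eventually_at_right_less[of a]
  proof eventually_elim
    case (elim u)
    then have "integral {a..u} f /\<^sub>R (u - a) - f a = (integral {a..u} f - (u - a) *\<^sub>R f a) /\<^sub>R (u - a)"
      by (simp add: scaleR_diff_right)
    with elim show ?case by (simp add: divide_inverse_commute)
  qed
  ultimately have "((\<lambda>u. integral {a..u} f /\<^sub>R (u - a) - f a) \<longlongrightarrow> 0) (at_right a)"
    by (rule Lim_null_comparison[rotated])
  then have "((\<lambda>u. integral {a..u} f /\<^sub>R (u - a)) \<longlongrightarrow> f a) (at_right a)"
    by (simp add: LIM_zero_iff)
  then show ?thesis
    by (simp add: at_right_to_0[of a] filterlim_filtermap add.commute)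
qed

section \<open>Strongly continuous semigroups\<close>

locale strongly_continuous_semigroup =
  fixes T :: "real \<Rightarrow> 'a::banach \<Rightarrow>\<^sub>L 'a"
  assumes C0: "C0_semigroup T"
begin

section \<open>Local boundedness and strong continuity of orbits\<close>

lemma T_0 [simp]: "T 0 x = x"
  using C0 by (simp add: C0_semigroup_def)

lemma T_add: "s \<ge> 0 \<Longrightarrow> t \<ge> 0 \<Longrightarrow> T (s + t) x = T s (T t x)"
  using C0 by (simp add: C0_semigroup_def)

lemma T_tendsto_right: "((\<lambda>t. T t x) \<longlongrightarrow> x) (at_right 0)"
  using C0 by (simp add: C0_semigroup_def)

text \<open>Otherwise the norms are unbounded along some times \<open>t n\<close> tending to 0. Each
  orbit converges along these times, so it is bounded there, and uniform boundedness gives a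
  contradiction.\<close>

lemma T_bounded_near_0: "\<exists>\<delta>>0. \<exists>M. \<forall>t\<in>{0..\<delta>}. norm (T t) \<le> M"
proof (rule ccontr)
  assume "\<not> ?thesis"
  then have "\<exists>t\<in>{0..\<delta>}. norm (T t) > M" if "\<delta> > 0" for \<delta> M
    using that by (meson not_le)
  \<comment> \<open>The summand \<open>norm (T 0)\<close> rules out \<open>t = 0\<close>, so the
    chosen times approach 0 strictly from the right, where strong continuity is given.\<close>
  then have "\<exists>t. 0 \<le> t \<and> t \<le> inverse (real (Suc n)) \<and> norm (T t) > real n + norm (T 0)" for n
    by (metis atLeastAtMost_iff inverse_positive_iff_positive of_nat_0_less_iff zero_less_Suc)
  then obtain t where t: "\<And>n. 0 \<le> t n" "\<And>n. t n \<le> inverse (real (Suc n))"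
    "\<And>n. norm (T (t n)) > real n + norm (T 0)"
    by metis
  have pos: "t n > 0" for n
    using t(1)[of n] t(3)[of n] by (cases "t n = 0") auto
  have lim: "filterlim t (at_right 0) sequentially"
    unfolding filterlim_at
  proof
    show "\<forall>\<^sub>F n in sequentially. t n \<in> {0<..} \<and> t n \<noteq> 0"
      using pos by (auto simp: less_imp_neq[symmetric])
    show "t \<longlonglongrightarrow> 0"
      by (rule tendsto_sandwich[OF _ _ tendsto_const LIMSEQ_inverse_real_of_nat])
        (use t(1,2) in \<open>auto simp del: of_nat_Suc\<close>)
  qed
  define p where "p x = (SUP n. ennreal (norm (T (t n) x)))" for x
  have p_le: "p x \<le> ennreal b \<longleftrightarrow> (\<forall>n. norm (T (t n) x) \<le> b)" if "b \<ge> 0" for x b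
    using that by (auto simp: p_def SUP_le_iff)
  have "\<exists>r>0. \<exists>B. \<forall>x. norm x \<le> r \<longrightarrow> p x \<le> ennreal B"
  proof (rule uniform_bound_ennreal)
    fix b :: nat
    have "{x. p x \<le> of_nat b} = {x. \<forall>n. norm (T (t n) x) \<le> real b}"
      using p_le[of "real b"] by (simp add: ennreal_of_nat_eq_real_of_nat)
    then show "closed {x. p x \<le> of_nat b}"
      by (auto intro!: closed_Collect_all closed_Collect_le continuous_intros)
  next
    fix x
    have "(\<lambda>n. T (t n) x) \<longlonglongrightarrow> x"
      using filterlim_compose[OF T_tendsto_right lim] .
    then have "Bseq (\<lambda>n. T (t n) x)"
      by (intro convergent_imp_Bseq convergentI)
    then obtain K where "K > 0" "\<And>n. norm (T (t n) x) \<le> K"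
      by (auto simp: Bseq_def)
    then have "p x \<le> ennreal K" using p_le[of K] by simp
    then show "p x < \<infinity>" by (simp add: le_less_trans)
  next
    fix x y
    show "p (x - y) \<le> ennreal 1 * (p x + p y)"
      unfolding p_def ennreal_1 mult_1
    proof (rule SUP_least)
      fix n
      have "ennreal (norm (T (t n) (x - y))) \<le> ennreal (norm (T (t n) x)) + ennreal (norm (T (t n) y))"
        by (simp add: blinfun.diff_right norm_triangle_ineq4 flip: ennreal_plus)
      also have "\<dots> \<le> (SUP n. ennreal (norm (T (t n) x))) + (SUP n. ennreal (norm (T (t n) y)))"
        by (intro add_mono SUP_upper) auto
      finally show "ennreal (norm (T (t n) (x - y))) \<le> \<dots>" .
    qed
  qed
  then obtain r B where r: "r > 0" and B: "\<And>x. norm x \<le> r \<Longrightarrow> p x \<le> ennreal B" by blast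
  have le: "norm (T (t n) x) \<le> max B 0" if "norm x \<le> r" for x n
  proof -
    have "p x \<le> ennreal (max B 0)"
      using B[OF that] by (metis ennreal_leI max.cobounded1 order_trans)
    then show ?thesis using p_le[of "max B 0"] by simp
  qed
  have "norm (T (t n)) \<le> max B 0 / r" for n
    by (rule norm_blinfun_le_cball[OF r le])
  moreover obtain n where "real n > max B 0 / r"
    using reals_Archimedean2 by blast
  ultimately show False
    using t(3)[of n] by (smt (verit) norm_ge_zero)
qed

text \<open>Induction over blocks of length \<open>\<delta>\<close>: each further block multiplies
  the bound by at most \<open>M\<close>.\<close>

lemma T_bounded: "\<exists>M>0. \<forall>t\<in>{0..N}. norm (T t) \<le> M"
proof -
  obtain \<delta> M where \<delta>: "\<delta> > 0" and M: "\<And>t. 0 \<le> t \<Longrightarrow> t \<le> \<delta> \<Longrightarrow> norm (T t) \<le> M"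
    using T_bounded_near_0 by (meson atLeastAtMost_iff)
  have M0: "M \<ge> 0"
    using M[of 0] \<delta> norm_ge_zero[of "T 0"] by linarith
  have "\<exists>L. \<forall>t\<in>{0..real n * \<delta>}. norm (T t) \<le> L" for n
  proof (induction n)
    case 0
    show ?case using M \<delta> by (intro exI[of _ M]) auto
  next
    case (Suc n)
    then obtain L where L: "\<And>t. 0 \<le> t \<Longrightarrow> t \<le> real n * \<delta> \<Longrightarrow> norm (T t) \<le> L"
      by (meson atLeastAtMost_iff)
    have "norm (T t) \<le> max M (L * M)" if "0 \<le> t" "t \<le> real (Suc n) * \<delta>" for t
    proof (cases "t \<le> \<delta>")
      case False
      then have T: "T t = T (t - \<delta>) o\<^sub>L T \<delta>"
        using T_add[of "t - \<delta>" \<delta>] \<delta> by (intro blinfun_eqI) simp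
      have "norm (T t) \<le> norm (T (t - \<delta>)) * norm (T \<delta>)"
        unfolding T by (rule norm_blinfun_compose)
      also have "\<dots> \<le> L * M"
        using that False \<delta> M0 norm_ge_zero order_trans L
        by (intro mult_mono') (auto simp: algebra_simps intro!: M L)
      finally show ?thesis by simp
    qed (use M that in \<open>auto intro: max.coboundedI1\<close>)
    then have "\<forall>t\<in>{0..real (Suc n) * \<delta>}. norm (T t) \<le> max M (L * M)" by simp
    then show ?case by blast
  qed
  moreover obtain n :: nat where "N < real n * \<delta>"
    using \<delta> reals_Archimedean3 by blast
  ultimately obtain L where "\<forall>t\<in>{0..real n * \<delta>}. norm (T t) \<le> L" by blast
  with \<open>N < real n * \<delta>\<close> show ?thesis
    by (intro exI[of _ "max L 1"]) (auto intro!: max.coboundedI1)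
qed

abbreviation D where "D \<equiv> gen_dom T"
abbreviation A where "A \<equiv> gen T"

text \<open>Factoring out the smaller of the two times turns an increment at any time, forward or
  backward, into one at time 0, where right-hand limits are known.\<close>

lemma T_diff:
  assumes "s \<ge> 0" "t \<ge> 0"
  shows "T s x - T t x = sgn (s - t) *\<^sub>R T (min s t) (T \<bar>s - t\<bar> x - x)"
  using assms T_add[of t "s - t" x] T_add[of s "t - s" x]
  by (cases "s < t") (auto simp: blinfun.diff_right sgn_if min_def)

lemma T_bounded_apply: "\<exists>M>0. \<forall>s\<in>{0..t}. \<forall>x. norm (T s x) \<le> M * norm x"
proof -
  obtain M where M: "M > 0" "\<forall>s\<in>{0..t}. norm (T s) \<le> M"
    using T_bounded by blast
  then have "\<forall>s\<in>{0..t}. \<forall>x. norm (T s x) \<le> M * norm x"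
    by (meson mult_right_mono norm_blinfun norm_ge_zero order_trans)
  with M(1) show ?thesis by blast
qed

lemma tendsto_abs_diff_within: "filterlim (\<lambda>s. \<bar>s - t\<bar>) (at_right 0) (at t within S)" for t :: real
  unfolding filterlim_at
proof
  show "\<forall>\<^sub>F s in at t within S. \<bar>s - t\<bar> \<in> {0<..} \<and> \<bar>s - t\<bar> \<noteq> 0"
    by (simp add: eventually_at_filter)
  have "((\<lambda>s. \<bar>s - t\<bar>) \<longlongrightarrow> \<bar>t - t\<bar>) (at t within S)"
    by (intro tendsto_intros)
  then show "((\<lambda>s. \<bar>s - t\<bar>) \<longlongrightarrow> 0) (at t within S)" by simp
qed

text \<open>In \<open>T_diff\<close> the outer time \<open>min s t\<close> stays in
  \<open>{0..t}\<close>, so a single bound \<open>M\<close> controls the outer operator on both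
  sides of \<open>t\<close>.\<close>

lemma T_continuous: "continuous_on {0..} (\<lambda>t. T t x)"
  unfolding continuous_on_def
proof
  fix t :: real assume t: "t \<in> {0..}"
  obtain M where M: "M > 0" "\<And>s x. 0 \<le> s \<Longrightarrow> s \<le> t \<Longrightarrow> norm (T s x) \<le> M * norm x"
    using T_bounded_apply[of t] by (meson atLeastAtMost_iff)
  have "((\<lambda>s. M * norm (T \<bar>s - t\<bar> x - x)) \<longlongrightarrow> M * norm (x - x)) (at t within {0..})"
    by (intro tendsto_intros filterlim_compose[OF T_tendsto_right tendsto_abs_diff_within])
  then have "((\<lambda>s. M * norm (T \<bar>s - t\<bar> x - x)) \<longlongrightarrow> 0) (at t within {0..})"
    by (simp only: diff_self norm_zero mult_zero_right)
  moreover have "\<forall>\<^sub>F s in at t within {0..}. norm (T s x - T t x) \<le> M * norm (T \<bar>s - t\<bar> x - x)"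
    using t by (auto simp: eventually_at_filter T_diff sgn_if intro!: always_eventually M)
  ultimately have "((\<lambda>s. T s x - T t x) \<longlongrightarrow> 0) (at t within {0..})"
    by (rule Lim_null_comparison[rotated])
  then show "((\<lambda>s. T s x) \<longlongrightarrow> T t x) (at t within {0..})"
    by (simp add: LIM_zero_iff)
qed

section \<open>The generator and its domain\<close>

lemma gen_tendsto:
  assumes "x \<in> D"
  shows "((\<lambda>h. (T h x - x) /\<^sub>R h) \<longlongrightarrow> A x) (at_right 0)"
  using assms unfolding gen_dom_def gen_def by (auto simp: tendsto_Lim)

lemma gen_eqI:
  assumes "((\<lambda>h. (T h x - x) /\<^sub>R h) \<longlongrightarrow> y) (at_right 0)"
  shows "x \<in> D" and "A x = y"
  using assms unfolding gen_dom_def gen_def by (auto simp: tendsto_Lim)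

lemma gen_add:
  assumes "x \<in> D" "y \<in> D"
  shows "x + y \<in> D" and "A (x + y) = A x + A y"
proof -
  have "((\<lambda>h. (T h x - x) /\<^sub>R h + (T h y - y) /\<^sub>R h) \<longlongrightarrow> A x + A y) (at_right 0)"
    by (intro tendsto_add gen_tendsto assms)
  then have "((\<lambda>h. (T h (x + y) - (x + y)) /\<^sub>R h) \<longlongrightarrow> A x + A y) (at_right 0)"
    by (simp add: blinfun.add_right algebra_simps)
  then show "x + y \<in> D" and "A (x + y) = A x + A y" by (rule gen_eqI)+
qed

lemma gen_scale:
  assumes "x \<in> D"
  shows "c *\<^sub>R x \<in> D" and "A (c *\<^sub>R x) = c *\<^sub>R A x"
proof -
  have "((\<lambda>h. c *\<^sub>R ((T h x - x) /\<^sub>R h)) \<longlongrightarrow> c *\<^sub>R A x) (at_right 0)"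
    by (intro tendsto_intros gen_tendsto assms)
  then have "((\<lambda>h. (T h (c *\<^sub>R x) - c *\<^sub>R x) /\<^sub>R h) \<longlongrightarrow> c *\<^sub>R A x) (at_right 0)"
    by (simp add: blinfun.scaleR_right scaleR_diff_right mult.commute)
  then show "c *\<^sub>R x \<in> D" and "A (c *\<^sub>R x) = c *\<^sub>R A x" by (rule gen_eqI)+
qed

lemma subspace_gen_dom: "subspace D"
proof (rule subspaceI)
  show "0 \<in> D" by (rule gen_eqI(1)[of _ 0]) (simp add: blinfun.zero_right)
qed (auto intro: gen_add gen_scale)

text \<open>The bounded operator \<open>T t\<close> commutes with the difference quotients at 0 and
  preserves their limit.\<close>

lemma gen_T:
  assumes "x \<in> D" "t \<ge> 0"
  shows "T t x \<in> D" and "A (T t x) = T t (A x)"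
proof -
  have "((\<lambda>h. T t ((T h x - x) /\<^sub>R h)) \<longlongrightarrow> T t (A x)) (at_right 0)"
    by (intro tendsto_intros gen_tendsto assms)
  moreover have "\<forall>\<^sub>F h in at_right 0. T t ((T h x - x) /\<^sub>R h) = (T h (T t x) - T t x) /\<^sub>R h"
    using eventually_at_right_less[of 0]
  proof eventually_elim
    case (elim h)
    then show ?case
      using T_add[of t h x] T_add[of h t x] assms(2)
      by (simp add: blinfun.diff_right blinfun.scaleR_right add.commute)
  qed
  ultimately have "((\<lambda>h. (T h (T t x) - T t x) /\<^sub>R h) \<longlongrightarrow> T t (A x)) (at_right 0)"
    by (rule Lim_transform_eventually)
  then show "T t x \<in> D" and "A (T t x) = T t (A x)" by (rule gen_eqI)+
qed

text \<open>By \<open>T_diff\<close> the two-sided difference quotient at \<open>t\<close> is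
  \<open>T (min s t)\<close> applied to a right-hand quotient at 0. The error splits into
  \<open>M\<close> times the error of that quotient, and the increment of the orbit of
  \<open>A x\<close>, which vanishes by strong continuity.\<close>

lemma T_has_vector_derivative:
  assumes x: "x \<in> D" and t: "t \<ge> 0"
  shows "((\<lambda>t. T t x) has_vector_derivative T t (A x)) (at t within {0..})"
  unfolding has_vector_derivative_def has_derivative_within
proof
  show "bounded_linear (\<lambda>h. h *\<^sub>R T t (A x))" by (rule bounded_linear_scaleR_left)
  obtain M where M: "M > 0" "\<And>s x. 0 \<le> s \<Longrightarrow> s \<le> t \<Longrightarrow> norm (T s x) \<le> M * norm x"
    using T_bounded_apply[of t] by (meson atLeastAtMost_iff)
  let ?q = "\<lambda>s. (T \<bar>s - t\<bar> x - x) /\<^sub>R \<bar>s - t\<bar>"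
  have "continuous_on {0..} (\<lambda>s. T (min s t) (A x))"
    using t by (intro continuous_on_compose2[OF T_continuous] continuous_intros) auto
  then have lim: "((\<lambda>s. T (min s t) (A x)) \<longlongrightarrow> T t (A x)) (at t within {0..})"
    using t by (force simp: continuous_on_def)
  have "((\<lambda>s. M * norm (?q s - A x) + norm (T (min s t) (A x) - T t (A x)))
      \<longlongrightarrow> M * norm (A x - A x) + norm (T t (A x) - T t (A x))) (at t within {0..})"
    by (intro tendsto_intros lim filterlim_compose[OF gen_tendsto[OF x] tendsto_abs_diff_within])
  then have "((\<lambda>s. M * norm (?q s - A x) + norm (T (min s t) (A x) - T t (A x))) \<longlongrightarrow> 0)
      (at t within {0..})"
    by (simp only: diff_self norm_zero mult_zero_right add_0)
  moreover have "\<forall>\<^sub>F s in at t within {0..}.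
    norm ((1 / norm (s - t)) *\<^sub>R (T s x - (T t x + (s - t) *\<^sub>R T t (A x))))
      \<le> M * norm (?q s - A x) + norm (T (min s t) (A x) - T t (A x))"
    unfolding eventually_at_filter
  proof (intro always_eventually allI impI)
    fix s assume s: "s \<noteq> t" "s \<in> {0..}"
    let ?d = "\<bar>s - t\<bar>" and ?y = "T t (A x)"
    have "T s x - (T t x + (s - t) *\<^sub>R ?y) = (T s x - T t x) - (sgn (s - t) * ?d) *\<^sub>R ?y"
      by (simp only: sgn_mult_abs diff_diff_eq)
    also have "\<dots> = sgn (s - t) *\<^sub>R (T (min s t) (T ?d x - x) - ?d *\<^sub>R ?y)"
      using s t by (subst T_diff) (simp_all only: scaleR_diff_right scaleR_scaleR atLeast_iff)
    also have "T (min s t) (T ?d x - x) - ?d *\<^sub>R ?y = ?d *\<^sub>R (T (min s t) (?q s) - ?y)"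
      using s by (simp add: scaleR_diff_right[of "?d"] blinfun.scaleR_right)
    finally have *: "T s x - (T t x + (s - t) *\<^sub>R ?y)
      = sgn (s - t) *\<^sub>R (?d *\<^sub>R (T (min s t) (?q s) - ?y))" .
    have "(1 / ?d) *\<^sub>R (sgn (s - t) *\<^sub>R (?d *\<^sub>R v)) = sgn (s - t) *\<^sub>R v" for v :: 'a
      using s by simp
    then have "(1 / norm (s - t)) *\<^sub>R (T s x - (T t x + (s - t) *\<^sub>R ?y))
      = sgn (s - t) *\<^sub>R (T (min s t) (?q s) - ?y)"
      unfolding real_norm_def * by blast
    then have "norm ((1 / norm (s - t)) *\<^sub>R (T s x - (T t x + (s - t) *\<^sub>R T t (A x))))
      = norm (T (min s t) (?q s) - T t (A x))"
      using s by (simp only: norm_scaleR) (simp add: abs_sgn_eq)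
    also have "\<dots> = norm (T (min s t) (?q s - A x) + (T (min s t) (A x) - T t (A x)))"
      by (simp add: blinfun.diff_right)
    also have "\<dots> \<le> norm (T (min s t) (?q s - A x)) + norm (T (min s t) (A x) - T t (A x))"
      by (rule norm_triangle_ineq)
    also have "norm (T (min s t) (?q s - A x)) \<le> M * norm (?q s - A x)"
      using s t by (intro M) auto
    finally show "norm ((1 / norm (s - t)) *\<^sub>R (T s x - (T t x + (s - t) *\<^sub>R T t (A x))))
      \<le> M * norm (?q s - A x) + norm (T (min s t) (A x) - T t (A x))" by simp
  qed
  ultimately show "((\<lambda>s. (1 / norm (s - t)) *\<^sub>R (T s x - (T t x + (s - t) *\<^sub>R T t (A x)))) \<longlongrightarrow> 0)
    (at t within {0..})"
    by (rule Lim_null_comparison[rotated])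
qed

text \<open>Applying \<open>T k\<close> shifts the interval of integration by \<open>k\<close>.
  After cancellation only the integrals over \<open>{h..h + k}\<close> and \<open>{0..k}\<close>
  remain, and divided by \<open>k\<close> they converge to \<open>T h x\<close> and
  \<open>x\<close>.\<close>

lemma integral_T_in_gen_dom:
  assumes "h > 0"
  shows "integral {0..h} (\<lambda>s. T s x) \<in> D"
proof (rule gen_eqI(1))
  have int: "(\<lambda>s. T s x) integrable_on {a..b}" if "a \<ge> 0" for a b
    using that by (intro integrable_continuous_interval continuous_on_subset[OF T_continuous]) auto
  have shift: "T k (integral {0..h} (\<lambda>s. T s x)) - integral {0..h} (\<lambda>s. T s x)
    = integral {h..h + k} (\<lambda>s. T s x) - integral {0..0 + k} (\<lambda>s. T s x)" if k: "k > 0" for k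
  proof -
    have "T k (integral {0..h} (\<lambda>s. T s x)) = integral {0..h} (T k \<circ> (\<lambda>s. T s x))"
      by (intro integral_linear[symmetric] int blinfun.bounded_linear_right) simp
    also have "\<dots> = integral {0..h} ((\<lambda>s. T s x) \<circ> (+) k)"
      using k by (intro integral_cong) (simp add: T_add)
    also have "\<dots> = integral {0 + k..h + k} (\<lambda>s. T s x)"
      by (rule integral_shift_Icc_real)
    finally have "T k (integral {0..h} (\<lambda>s. T s x)) = integral {k..h + k} (\<lambda>s. T s x)" by simp
    moreover have "integral {0..k} (\<lambda>s. T s x) + integral {k..h + k} (\<lambda>s. T s x)
      = integral {0..h + k} (\<lambda>s. T s x)"
      using k assms by (intro Henstock_Kurzweil_Integration.integral_combine int) auto
    moreover have "integral {0..h} (\<lambda>s. T s x) + integral {h..h + k} (\<lambda>s. T s x)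
      = integral {0..h + k} (\<lambda>s. T s x)"
      using k assms by (intro Henstock_Kurzweil_Integration.integral_combine int) auto
    ultimately show ?thesis by (simp add: algebra_simps)
  qed
  have "((\<lambda>k. integral {h..h + k} (\<lambda>s. T s x) /\<^sub>R k - integral {0..0 + k} (\<lambda>s. T s x) /\<^sub>R k)
    \<longlongrightarrow> T h x - T 0 x) (at_right 0)"
    using assms by (intro tendsto_diff integral_mean_tendsto continuous_on_subset[OF T_continuous]) auto
  moreover have "\<forall>\<^sub>F k in at_right 0.
      integral {h..h + k} (\<lambda>s. T s x) /\<^sub>R k - integral {0..0 + k} (\<lambda>s. T s x) /\<^sub>R k
      = (T k (integral {0..h} (\<lambda>s. T s x)) - integral {0..h} (\<lambda>s. T s x)) /\<^sub>R k"
    using eventually_at_right_less[of 0]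
    by eventually_elim (simp only: shift scaleR_diff_right)
  ultimately show "((\<lambda>k. (T k (integral {0..h} (\<lambda>s. T s x)) - integral {0..h} (\<lambda>s. T s x)) /\<^sub>R k)
    \<longlongrightarrow> T h x - T 0 x) (at_right 0)"
    by (rule Lim_transform_eventually)
qed

text \<open>The means of an orbit over short intervals \<open>{0..h}\<close> lie in the domain and
  converge to its starting point.\<close>

lemma closure_gen_dom: "closure D = UNIV"
proof -
  have "T 0 x \<in> closure D" for x
  proof (rule Lim_in_closed_set)
    show "((\<lambda>h. integral {0..0 + h} (\<lambda>s. T s x) /\<^sub>R h) \<longlongrightarrow> T 0 x) (at_right 0)"
      by (intro integral_mean_tendsto T_continuous)
    show "\<forall>\<^sub>F h in at_right 0. integral {0..0 + h} (\<lambda>s. T s x) /\<^sub>R h \<in> closure D"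
      using eventually_at_right_less[of 0]
      by eventually_elim (auto intro!: subsetD[OF closure_subset] gen_scale(1) integral_T_in_gen_dom)
  qed auto
  then show ?thesis by auto
qed

end

section \<open>The Lyapunov equation\<close>

lemma sym_ops_iff: "P \<in> sym_ops \<longleftrightarrow> (\<forall>x y. P x y = P y x)"
proof
  assume "P \<in> sym_ops"
  then have "P x y = form_adjoint P x y" for x y
    by (simp add: sym_ops_def)
  then show "\<forall>x y. P x y = P y x"
    by (simp add: form_adjoint_apply)
next
  assume "\<forall>x y. P x y = P y x"
  then show "P \<in> sym_ops"
    by (auto simp: sym_ops_def form_adjoint_apply intro!: blinfun_eqI)
qed

lemma bounded_extension_eqI:
  assumes "closure D = UNIV" and "\<And>x. x \<in> D \<Longrightarrow> blinfun_apply B x = F x"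
  shows "bounded_extension D F = B"
  unfolding bounded_extension_def
  using assms by (intro the_equality) (auto intro: blinfun_eq_on_dense)

text \<open>The origin is excluded because its quotient in \<open>norm_on\<close> is 0 whatever the
  value \<open>F 0\<close>.\<close>

lemma norm_on_bound:
  assumes "norm_on D F < \<infinity>" "x \<in> D" "x \<noteq> 0"
  shows "norm (F x) \<le> enn2real (norm_on D F) * norm x"
proof -
  have "ennreal (norm (F x) / norm x) \<le> norm_on D F"
    unfolding norm_on_def using assms(2) by (rule SUP_upper)
  also have "\<dots> = ennreal (enn2real (norm_on D F))"
    using assms(1) by simp
  finally have "norm (F x) / norm x \<le> enn2real (norm_on D F)"
    by simp
  then show ?thesis
    using assms(3) by (simp add: divide_le_eq)
qed

context strongly_continuous_semigroup begin

text \<open>The weak form of the equation, tested on pairs from the domain. It avoids adjoint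
  domains and definite descriptions, so the analysis is carried out on it alone.\<close>

definition lyapunov_equation :: "('a \<Rightarrow>\<^sub>L 'a dual) \<Rightarrow> ('a \<Rightarrow>\<^sub>L 'a dual) \<Rightarrow> bool" where
  "lyapunov_equation P Q \<longleftrightarrow> (\<forall>x\<in>D. \<forall>y\<in>D. P (A x) y + P x (A y) = Q x y)"

lemma gen_adj_eqI:
  assumes "\<And>x. x \<in> D \<Longrightarrow> blinfun_apply g x = blinfun_apply f (A x)"
  shows "gen_adj T f = g"
  unfolding adj_op_def
  using assms by (intro the_equality) (auto intro!: blinfun_eq_on_dense[OF closure_gen_dom])

lemma gen_adj_apply:
  assumes "f \<in> gen_adj_dom T" "x \<in> D"
  shows "gen_adj T f x = f (A x)"
proof -
  obtain g :: "'a dual" where g: "\<forall>x\<in>D. g x = f (A x)"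
    using assms(1) by (auto simp: adj_dom_def)
  then have "gen_adj T f = g" by (intro gen_adj_eqI) auto
  with g assms(2) show ?thesis by simp
qed

text \<open>The weak form shows that \<open>Q x - P (A x)\<close> is the value of the adjoint of
  \<open>A\<close> at \<open>P x\<close>; hence \<open>lyapunov_expr T P\<close> agrees with
  \<open>Q\<close> on the domain, and \<open>norm Q\<close> bounds it there.\<close>

lemma
  assumes "lyapunov_equation P Q"
  shows lyapunov_equation_imp_dom: "blinfun_apply P ` D \<subseteq> gen_adj_dom T"
    and lyapunov_equation_imp_norm_on: "norm_on D (lyapunov_expr T P) < \<infinity>"
    and lyapunov_equation_imp_extension: "bounded_extension D (lyapunov_expr T P) = Q"
proof -
  have *: "blinfun_apply (Q x - P (A x)) y = blinfun_apply (P x) (A y)" if "x \<in> D" "y \<in> D" for x y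
    using assms that unfolding lyapunov_equation_def by (simp add: blinfun.diff_left algebra_simps)
  then show "blinfun_apply P ` D \<subseteq> gen_adj_dom T"
    unfolding adj_dom_def by blast
  have expr: "lyapunov_expr T P x = Q x" if "x \<in> D" for x
    using gen_adj_eqI[of "Q x - P (A x)" "P x"] *[OF that] by (simp add: lyapunov_expr_def)
  have "norm_on D (lyapunov_expr T P) \<le> ennreal (norm Q)"
    unfolding norm_on_def
  proof (rule SUP_least)
    fix x assume x: "x \<in> D"
    show "ennreal (norm (lyapunov_expr T P x) / norm x) \<le> ennreal (norm Q)"
      using norm_blinfun[of Q x] by (cases "x = 0") (auto simp: expr[OF x] divide_le_eq)
  qed
  then show "norm_on D (lyapunov_expr T P) < \<infinity>"
    by (simp add: le_less_trans)
  show "bounded_extension D (lyapunov_expr T P) = Q"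
    using expr by (intro bounded_extension_eqI closure_gen_dom) simp
qed

text \<open>The pairing of \<open>lyapunov_expr T P x\<close> with domain vectors is explicit, so
  density makes the expression linear in \<open>x\<close>. Being bounded, it extends to the whole
  space, and the description in \<open>bounded_extension\<close> then denotes this
  extension.\<close>

lemma lyapunov_equationI:
  assumes dom: "blinfun_apply P ` D \<subseteq> gen_adj_dom T" and fin: "norm_on D (lyapunov_expr T P) < \<infinity>"
  shows "lyapunov_equation P (bounded_extension D (lyapunov_expr T P))"
proof -
  let ?F = "lyapunov_expr T P" and ?B = "bounded_extension D (lyapunov_expr T P)"
  have F: "?F x y = P (A x) y + P x (A y)" if "x \<in> D" "y \<in> D" for x y
    using gen_adj_apply[of "P x" y] dom that
    by (auto simp: lyapunov_expr_def blinfun.add_left)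
  have add: "?F (x + y) = ?F x + ?F y" if "x \<in> D" "y \<in> D" for x y
    by (rule blinfun_eq_on_dense[OF closure_gen_dom])
      (simp add: F that gen_add blinfun.add_left blinfun.add_right)
  have scale: "?F (a *\<^sub>R x) = a *\<^sub>R ?F x" if "x \<in> D" for a x
    by (rule blinfun_eq_on_dense[OF closure_gen_dom])
      (simp add: F that gen_scale blinfun.scaleR_left blinfun.scaleR_right algebra_simps)
  \<comment> \<open>The finite norm gives no information at the origin, so linearity has to supply
    the bound there.\<close>
  have "?F 0 = 0"
    using scale[of 0 0] subspace_0[OF subspace_gen_dom] by simp
  then have "norm (?F x) \<le> enn2real (norm_on D ?F) * norm x" if "x \<in> D" for x
    using norm_on_bound[OF fin that] by (cases "x = 0") auto
  then obtain B where B: "\<forall>x\<in>D. blinfun_apply B x = ?F x"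
    using blinfun_extend_dense[OF subspace_gen_dom closure_gen_dom add scale] by meson
  then have "?B = B"
    by (intro bounded_extension_eqI closure_gen_dom) auto
  with B F show ?thesis
    by (simp add: lyapunov_equation_def)
qed

text \<open>The dictionary between the Lyapunov generator and the weak form.\<close>

lemma lyapunov_dom_iff:
  "P \<in> lyapunov_dom T \<and> lyapunov_gen T P = Q \<longleftrightarrow> P \<in> sym_ops \<and> lyapunov_equation P Q"
  unfolding lyapunov_dom_def lyapunov_gen_def
  using lyapunov_equationI[of P] lyapunov_equation_imp_dom[of P Q]
    lyapunov_equation_imp_norm_on[of P Q] lyapunov_equation_imp_extension[of P Q]
  by auto

lemma lyapunov_equation_diff:
  assumes "lyapunov_equation P Q" "lyapunov_equation P' Q'"
  shows "lyapunov_equation (P - P') (Q - Q')"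
  using assms
  unfolding lyapunov_equation_def blinfun.diff_left by (metis (no_types) add_diff_add)

lemma lyapunov_equation_minus: "lyapunov_equation P Q \<Longrightarrow> lyapunov_equation (- P) (- Q)"
  unfolding lyapunov_equation_def blinfun.minus_left by (metis minus_add_distrib)

lemma form_eq_on_gen_dom:
  fixes f g :: "'a \<Rightarrow>\<^sub>L 'a dual"
  assumes "\<And>x y. x \<in> D \<Longrightarrow> y \<in> D \<Longrightarrow> f x y = g x y"
  shows "f = g"
  by (intro blinfun_eq_on_dense[OF closure_gen_dom] assms)

text \<open>This places the range of the Lyapunov generator inside \<open>sym_ops\<close>; symmetry
  on the domain extends by density.\<close>

lemma lyapunov_equation_sym:
  assumes "P \<in> sym_ops" "lyapunov_equation P Q"
  shows "Q \<in> sym_ops"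
proof -
  have "Q = form_adjoint Q"
  proof (rule form_eq_on_gen_dom)
    fix x y assume xy: "x \<in> D" "y \<in> D"
    have "Q x y = P (A x) y + P x (A y)" "Q y x = P (A y) x + P y (A x)"
      using assms(2) xy by (simp_all add: lyapunov_equation_def)
    with assms(1) show "Q x y = form_adjoint Q x y"
      by (simp add: form_adjoint_apply sym_ops_iff)
  qed
  then show ?thesis by (simp add: sym_ops_def)
qed

section \<open>Bilinear forms along trajectories\<close>

lemma form_has_vector_derivative:
  fixes P :: "'a \<Rightarrow>\<^sub>L 'a dual"
  assumes "x \<in> D" "y \<in> D" "t \<ge> 0"
  shows "((\<lambda>t. P (T t x) (T t y)) has_vector_derivative
    P (T t (A x)) (T t y) + P (T t x) (T t (A y))) (at t within {0..})"
proof -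
  have "bounded_bilinear (\<lambda>x y. P x y)"
    by (rule bounded_bilinear.comp1[OF bounded_bilinear_blinfun_apply blinfun.bounded_linear_right])
  from bounded_bilinear.has_vector_derivative[OF this
      T_has_vector_derivative T_has_vector_derivative, OF assms(1,3,2,3)]
  show ?thesis by (simp add: add.commute)
qed

text \<open>The domain is invariant and \<open>A\<close> commutes with \<open>T t\<close>, so the
  equation may be tested at \<open>T t x\<close> and \<open>T t y\<close>.\<close>

lemma lyapunov_equation_has_vector_derivative:
  assumes "lyapunov_equation P Q" "x \<in> D" "y \<in> D" "t \<ge> 0"
  shows "((\<lambda>t. P (T t x) (T t y)) has_vector_derivative Q (T t x) (T t y)) (at t within {0..})"
proof -
  have "Q (T t x) (T t y) = P (T t (A x)) (T t y) + P (T t x) (T t (A y))"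
    using assms gen_T[of x t] gen_T[of y t] by (simp add: lyapunov_equation_def flip: gen_T(2))
  then show ?thesis
    using form_has_vector_derivative[of x y t P] assms by simp
qed

lemma continuous_on_form:
  fixes P :: "'a \<Rightarrow>\<^sub>L 'a dual"
  shows "continuous_on {0..} (\<lambda>t. P (T t x) (T t y))"
  by (intro continuous_intros T_continuous)

text \<open>The integrated equation, from which both the output energy bound and uniqueness
  follow.\<close>

lemma lyapunov_equation_identity:
  assumes "lyapunov_equation P Q" "x \<in> D" "y \<in> D" "t \<ge> 0"
  shows "((\<lambda>s. Q (T s x) (T s y)) has_integral P (T t x) (T t y) - P x y) {0..t}"
proof -
  have "((\<lambda>s. Q (T s x) (T s y)) has_integral P (T t x) (T t y) - P (T 0 x) (T 0 y)) {0..t}"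
    by (rule fundamental_theorem_of_calculus)
      (auto intro!: has_vector_derivative_within_subset[OF lyapunov_equation_has_vector_derivative] assms)
  then show ?thesis by simp
qed

section \<open>Datko's theorem\<close>

text \<open>The integral in \<open>detectable_L2\<close>, for a general observation;
  \<open>id_blinfun\<close> observes the trajectory itself. Values in \<open>ennreal\<close> allow
  an infinite energy.\<close>

definition energy :: "('a \<Rightarrow>\<^sub>L 'b::real_normed_vector) \<Rightarrow> 'a \<Rightarrow> ennreal" where
  "energy C x = (\<integral>\<^sup>+t\<in>{0..}. ennreal ((norm (C (T t x)))\<^sup>2) \<partial>lborel)"

lemma energy_measurable [measurable]:
  fixes C :: "'a \<Rightarrow>\<^sub>L 'b::real_normed_vector"
  shows "(\<lambda>t. ennreal ((norm (C (T t x)))\<^sup>2) * indicator {0..} t) \<in> borel_measurable borel"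
proof -
  have "(\<lambda>t. indicator {0..} t *\<^sub>R (norm (C (T t x)))\<^sup>2) \<in> borel_measurable borel"
    by (intro borel_measurable_continuous_on_indicator continuous_intros T_continuous) auto
  then have "(\<lambda>t. ennreal (indicator {0..} t *\<^sub>R (norm (C (T t x)))\<^sup>2)) \<in> borel_measurable borel"
    by measurable
  also have "(\<lambda>t. ennreal (indicator {0..} t *\<^sub>R (norm (C (T t x)))\<^sup>2))
    = (\<lambda>t. ennreal ((norm (C (T t x)))\<^sup>2) * indicator {0..} t)"
    by (auto simp: indicator_def)
  finally show ?thesis .
qed

text \<open>Fatou's lemma: the energy is lower semicontinuous in the initial state.\<close>

lemma closed_energy_le:
  fixes C :: "'a \<Rightarrow>\<^sub>L 'b::real_normed_vector"
  shows "closed {x. energy C x \<le> b}"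
  unfolding closed_sequential_limits
proof (intro allI impI, elim conjE)
  fix x :: "nat \<Rightarrow> 'a" and l
  assume le: "\<forall>n. x n \<in> {x. energy C x \<le> b}" and lim: "x \<longlonglongrightarrow> l"
  let ?f = "\<lambda>x t. ennreal ((norm (C (T t x)))\<^sup>2) * indicator {0..} t"
  have "(\<lambda>n. ?f (x n) t) \<longlonglongrightarrow> ?f l t" for t
  proof (cases "t \<in> {0..}")
    case True
    have "(\<lambda>n. ennreal ((norm (C (T t (x n))))\<^sup>2)) \<longlonglongrightarrow> ennreal ((norm (C (T t l)))\<^sup>2)"
      by (intro tendsto_intros tendsto_ennrealI lim)
    with True show ?thesis by simp
  qed simp
  then have "liminf (\<lambda>n. ?f (x n) t) = ?f l t" for t
    by (intro lim_imp_Liminf) auto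
  then have "energy C l = (\<integral>\<^sup>+t. liminf (\<lambda>n. ?f (x n) t) \<partial>lborel)"
    by (simp add: energy_def)
  also have "\<dots> \<le> liminf (\<lambda>n. energy C (x n))"
    unfolding energy_def by (intro nn_integral_liminf) simp
  also have "\<dots> \<le> b"
    using le by (intro Liminf_le) auto
  finally show "l \<in> {x. energy C x \<le> b}" by simp
qed

text \<open>Together with \<open>closed_energy_le\<close> this makes
  \<open>uniform_bound_ennreal\<close> applicable to the energy; the factor 2 comes from squaring
  the triangle inequality.\<close>

lemma energy_diff:
  fixes C :: "'a \<Rightarrow>\<^sub>L 'b::real_normed_vector"
  shows "energy C (x - y) \<le> ennreal 2 * (energy C x + energy C y)"
proof -
  let ?f = "\<lambda>x t. ennreal ((norm (C (T t x)))\<^sup>2) * indicator {0..} t"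
  have "(norm (a - b))\<^sup>2 \<le> 2 * ((norm a)\<^sup>2 + (norm b)\<^sup>2)" for a b :: 'b
  proof -
    have "(norm (a - b))\<^sup>2 \<le> (norm a + norm b)\<^sup>2"
      by (intro power_mono norm_triangle_ineq4) auto
    also have "\<dots> \<le> 2 * ((norm a)\<^sup>2 + (norm b)\<^sup>2)"
      using sum_squares_bound[of "norm a" "norm b"] by (simp add: power2_sum)
    finally show ?thesis .
  qed
  then have "ennreal ((norm (C (T t (x - y))))\<^sup>2)
      \<le> ennreal 2 * (ennreal ((norm (C (T t x)))\<^sup>2) + ennreal ((norm (C (T t y)))\<^sup>2))" for t
    by (simp add: blinfun.diff_right ennreal_leI flip: ennreal_plus ennreal_mult'' del: ennreal_numeral)
  then have "energy C (x - y) \<le> (\<integral>\<^sup>+t. ennreal 2 * (?f x t + ?f y t) \<partial>lborel)"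
    unfolding energy_def by (intro nn_integral_mono) (auto simp: indicator_def)
  also have "\<dots> = ennreal 2 * (energy C x + energy C y)"
    unfolding energy_def by (subst nn_integral_cmult) (auto simp: nn_integral_add)
  finally show ?thesis .
qed

text \<open>For \<open>s \<le> t\<close> the semigroup property gives \<open>\<parallel>T(t)x\<parallel> \<le> \<parallel>T(t - s)\<parallel> \<parallel>T(s)x\<parallel>\<close>; square and
  integrate over \<open>s\<close>.\<close>

lemma norm_T_le_energy:
  assumes "0 \<le> a" "a \<le> t" and M: "\<And>s. 0 \<le> s \<Longrightarrow> s \<le> t - a \<Longrightarrow> norm (T s) \<le> M"
    and B: "energy id_blinfun x \<le> ennreal B" "0 \<le> B"
  shows "(t - a) * (norm (T t x))\<^sup>2 \<le> M\<^sup>2 * B"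
proof -
  have "ennreal ((t - a) * (norm (T t x))\<^sup>2) = (\<integral>\<^sup>+s\<in>{a..t}. ennreal ((norm (T t x))\<^sup>2) \<partial>lborel)"
    using assms(2) by (subst nn_integral_cmult_indicator) (auto simp: ennreal_mult'' mult.commute)
  also have "\<dots> \<le> (\<integral>\<^sup>+s. ennreal (M\<^sup>2) * (ennreal ((norm (id_blinfun (T s x)))\<^sup>2) * indicator {0..} s) \<partial>lborel)"
  proof (intro nn_integral_mono)
    fix s
    show "ennreal ((norm (T t x))\<^sup>2) * indicator {a..t} s
      \<le> ennreal (M\<^sup>2) * (ennreal ((norm (id_blinfun (T s x)))\<^sup>2) * indicator {0..} s)"
    proof (cases "s \<in> {a..t}")
      case True
      then have "norm (T t x) \<le> norm (T (t - s)) * norm (T s x)"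
        using T_add[of "t - s" s x] assms(1) norm_blinfun[of "T (t - s)" "T s x"] by simp
      also have "\<dots> \<le> M * norm (T s x)"
        using True by (intro mult_right_mono M) auto
      finally have "(norm (T t x))\<^sup>2 \<le> M\<^sup>2 * (norm (T s x))\<^sup>2"
        unfolding power_mult_distrib[symmetric] by (intro power_mono) auto
      with True assms(1) show ?thesis
        by (simp add: ennreal_leI flip: ennreal_mult'')
    qed simp
  qed
  also have "\<dots> = ennreal (M\<^sup>2) * energy id_blinfun x"
    unfolding energy_def using energy_measurable[of id_blinfun x] by (intro nn_integral_cmult) simp
  also have "\<dots> \<le> ennreal (M\<^sup>2) * ennreal B"
    by (intro mult_left_mono B) simp
  also have "\<dots> = ennreal (M\<^sup>2 * B)"
    using B by (simp add: ennreal_mult'')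
  finally show ?thesis
    using B by (simp add: ennreal_le_iff)
qed

text \<open>Writing \<open>t\<close> as a remainder plus \<open>n\<close> steps of length
  \<open>t0\<close> bounds the norm by \<open>L\<close> times \<open>n\<close> halvings, which is
  decay at rate \<open>ln 2 / t0\<close>.\<close>

lemma exponentially_stableI:
  assumes t0: "t0 > 0" "norm (T t0) \<le> 1 / 2" and L: "\<And>t. t \<ge> 0 \<Longrightarrow> norm (T t) \<le> L"
  shows "exponentially_stable T"
proof -
  define e where "e = ln 2 / t0"
  have "e > 0" using t0 by (simp add: e_def)
  have L0: "L \<ge> 0" using L[of 0] norm_ge_zero[of "T 0"] by linarith
  have pow: "norm (T (s + real n * t0)) \<le> L * (1 / 2) ^ n" if "s \<ge> 0" for n s
  proof (induction n)
    case 0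
    show ?case using L that by simp
  next
    case (Suc n)
    have "T (s + real (Suc n) * t0) = T t0 o\<^sub>L T (s + real n * t0)"
      using T_add[of t0 "s + real n * t0"] t0 that by (intro blinfun_eqI) (simp add: algebra_simps)
    then have "norm (T (s + real (Suc n) * t0)) \<le> norm (T t0) * norm (T (s + real n * t0))"
      by (simp add: norm_blinfun_compose)
    also have "\<dots> \<le> 1 / 2 * (L * (1 / 2) ^ n)"
      using t0 Suc.IH by (intro mult_mono) auto
    finally show ?case by simp
  qed
  \<comment> \<open>The factor 2 pays for rounding \<open>t / t0\<close> down; the summand 1 keeps
    the constant positive when \<open>L = 0\<close>.\<close>
  have "norm (T t) \<le> (2 * L + 1) * exp (- e * t)" if t: "t \<ge> 0" for t
  proof -
    define n where "n = nat \<lfloor>t / t0\<rfloor>"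
    have "real n \<le> t / t0" "t / t0 \<le> real n + 1"
      using t t0 by (simp_all add: n_def)
    then have n: "real n * t0 \<le> t" "t \<le> (real n + 1) * t0"
      using t0 by (simp_all add: field_simps)
    have "norm (T t) \<le> L * (1 / 2) ^ n"
      using pow[of "t - real n * t0" n] n by simp
    also have "(1 / 2 :: real) ^ n = exp (- ln 2 * real n)"
      by (simp add: exp_of_nat2_mult exp_minus power_one_over inverse_eq_divide)
    also have "\<dots> \<le> exp (ln 2 + - e * t)"
    proof -
      have "e * t \<le> e * ((real n + 1) * t0)"
        using n \<open>e > 0\<close> by (intro mult_left_mono) auto
      also have "\<dots> = ln 2 * (real n + 1)"
        using t0 by (simp add: e_def)
      finally show ?thesis by (simp add: algebra_simps)
    qed
    also have "\<dots> = 2 * exp (- e * t)"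
      by (simp only: exp_add) simp
    finally have "norm (T t) \<le> 2 * L * exp (- e * t)"
      using L0 by (simp add: mult_left_mono)
    also have "\<dots> \<le> (2 * L + 1) * exp (- e * t)"
      by (intro mult_right_mono) auto
    finally show ?thesis .
  qed
  moreover have "2 * L + 1 > 0" using L0 by simp
  ultimately show ?thesis
    using \<open>e > 0\<close> unfolding exponentially_stable_def by blast
qed

text \<open>Uniform boundedness gives one energy bound \<open>B\<close> on a ball. Integrating over
  windows then shows first that the semigroup is bounded and next that its norm is at most
  \<open>1 / 2\<close> at some time.\<close>

theorem Datko:
  assumes "\<And>x. energy id_blinfun x < \<infinity>"
  shows "exponentially_stable T"
proof -
  have "\<exists>r>0. \<exists>B. \<forall>x. norm x \<le> r \<longrightarrow> energy id_blinfun x \<le> ennreal B"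
    by (rule uniform_bound_ennreal[OF closed_energy_le assms energy_diff])
  then obtain r B0 where r: "r > 0"
    and B0: "\<And>x. norm x \<le> r \<Longrightarrow> energy id_blinfun x \<le> ennreal B0" by blast
  define B where "B = max B0 0"
  have B: "B \<ge> 0" "\<And>x. norm x \<le> r \<Longrightarrow> energy id_blinfun x \<le> ennreal B"
    using B0 by (auto simp: B_def intro!: order_trans[OF B0 ennreal_leI])
  \<comment> \<open>The estimate over a window \<open>{a..t}\<close>. It is used with windows of
    length 1 for boundedness and with \<open>{0..t0}\<close> for decay.\<close>
  have *: "norm (T t) \<le> sqrt (M\<^sup>2 * B / (t - a)) / r"
    if "0 \<le> a" "a < t" "\<And>s. 0 \<le> s \<Longrightarrow> s \<le> t - a \<Longrightarrow> norm (T s) \<le> M" for a t M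
  proof (rule norm_blinfun_le_cball[OF r])
    fix x :: 'a assume "norm x \<le> r"
    then have "(t - a) * (norm (T t x))\<^sup>2 \<le> M\<^sup>2 * B"
      using that B by (intro norm_T_le_energy) auto
    then have "(norm (T t x))\<^sup>2 \<le> M\<^sup>2 * B / (t - a)"
      using that by (simp add: field_simps)
    then show "norm (T t x) \<le> sqrt (M\<^sup>2 * B / (t - a))"
      by (rule real_le_rsqrt)
  qed
  obtain M where M: "M > 0" "\<And>s. 0 \<le> s \<Longrightarrow> s \<le> 1 \<Longrightarrow> norm (T s) \<le> M"
    using T_bounded[of 1] by (meson atLeastAtMost_iff)
  define L where "L = max M (sqrt (M\<^sup>2 * B) / r)"
  have L: "norm (T t) \<le> L" if "t \<ge> 0" for t
    using *[of "t - 1" t M] M that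
    by (cases "t \<le> 1") (auto simp: L_def intro: max.coboundedI1 max.coboundedI2)
  \<comment> \<open>Chosen so that the estimate over \<open>{0..t0}\<close> is at most
    \<open>1 / 2\<close>; the summand 1 ensures that \<open>t0\<close> is positive.\<close>
  define t0 where "t0 = 4 * (L\<^sup>2 * B) / r\<^sup>2 + 1"
  have t0: "t0 > 0" using B by (simp add: t0_def add_nonneg_pos)
  have "L\<^sup>2 * B / t0 \<le> (r / 2)\<^sup>2"
    using t0 r by (simp add: divide_le_eq) (simp add: t0_def field_simps)
  then have "sqrt (L\<^sup>2 * B / t0) \<le> r / 2"
    using r by (intro real_le_lsqrt) auto
  then have "sqrt (L\<^sup>2 * B / t0) / r \<le> 1 / 2"
    using r by (simp add: divide_le_eq)
  moreover have "norm (T t0) \<le> sqrt (L\<^sup>2 * B / t0) / r"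
    using *[of 0 t0 L] t0 L by simp
  ultimately have "norm (T t0) \<le> 1 / 2" by (rule order_trans[rotated])
  with t0 L show ?thesis by (intro exponentially_stableI[of t0 L])
qed

end

section \<open>The observability Gramian\<close>

text \<open>Domination by an exponential. The start \<open>c = 0\<close> later bounds the Gramian,
  while large \<open>c\<close> controls the tails.\<close>

lemma
  fixes f :: "real \<Rightarrow> real"
  assumes cont: "continuous_on {0..} f" and "a > 0" "c \<ge> 0"
    and bound: "\<And>t. t \<ge> 0 \<Longrightarrow> \<bar>f t\<bar> \<le> K * exp (- a * t)"
  shows integrable_on_exp_bound: "f integrable_on {c..}"
    and integral_exp_bound: "\<bar>integral {c..} f\<bar> \<le> K * exp (- a * c) / a"
proof -
  have exp: "((\<lambda>t. K * exp (- a * t)) has_integral K * (exp (- a * c) / a)) {c..}"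
    by (intro has_integral_mult_right has_integral_exp_minus_to_infinity \<open>a > 0\<close>)
  have "continuous_on {c..} f"
    using cont by (rule continuous_on_subset) (use \<open>c \<ge> 0\<close> in auto)
  then have "f \<in> borel_measurable (lebesgue_on {c..})"
    by (intro continuous_imp_measurable_on_sets_lebesgue) auto
  then show int: "f integrable_on {c..}"
    by (rule measurable_bounded_by_integrable_imp_integrable)
      (use bound exp \<open>c \<ge> 0\<close> in \<open>auto simp: integrable_on_def\<close>)
  have "norm (integral {c..} f) \<le> integral {c..} (\<lambda>t. K * exp (- a * t))"
    using int exp bound \<open>c \<ge> 0\<close> by (intro integral_norm_bound_integral) (auto simp: integrable_on_def)
  also have "\<dots> = K * (exp (- a * c) / a)"
    using exp by (rule integral_unique)
  finally show "\<bar>integral {c..} f\<bar> \<le> K * exp (- a * c) / a" by simp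
qed

text \<open>Splitting at \<open>c\<close> gives \<open>F c - F 0\<close> plus a tail; both
  \<open>F c\<close> and the tail vanish as \<open>c\<close> grows.\<close>

lemma integral_half_line_FTC:
  fixes f F :: "real \<Rightarrow> real"
  assumes cont: "continuous_on {0..} f" and "a > 0"
    and bound: "\<And>t. t \<ge> 0 \<Longrightarrow> \<bar>f t\<bar> \<le> K * exp (- a * t)"
    and deriv: "\<And>t. t \<ge> 0 \<Longrightarrow> (F has_vector_derivative f t) (at t within {0..})"
    and lim: "(F \<longlongrightarrow> 0) at_top"
  shows "integral {0..} f = - F 0"
proof -
  have "((\<lambda>c. exp (- a * c)) \<longlongrightarrow> 0) at_top"
    using \<open>a > 0\<close> by (intro filterlim_compose[OF exp_at_bot]
        filterlim_tendsto_neg_mult_at_bot[OF tendsto_const] filterlim_ident) auto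
  from tendsto_mult_left[OF this, of "K / a"]
  have "((\<lambda>c. K * exp (- a * c) / a) \<longlongrightarrow> 0) at_top" by simp
  moreover have "\<forall>\<^sub>F c in at_top. norm (integral {c..} f) \<le> K * exp (- a * c) / a"
    using eventually_ge_at_top[of 0]
    by eventually_elim (use integral_exp_bound[OF cont \<open>a > 0\<close> _ bound] in auto)
  ultimately have tail: "((\<lambda>c. integral {c..} f) \<longlongrightarrow> 0) at_top"
    by (rule Lim_null_comparison[rotated])
  have "\<forall>\<^sub>F c in at_top. integral {c..} f + F c - F 0 = integral {0..} f"
    using eventually_ge_at_top[of 0]
  proof eventually_elim
    case (elim c)
    have "(f has_integral F c - F 0) {0..c}"
      using elim by (intro fundamental_theorem_of_calculus has_vector_derivative_within_subset[OF deriv]) auto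
    moreover have "(f has_integral integral {c..} f) {c..}"
      by (rule integrable_integral[OF integrable_on_exp_bound[OF cont \<open>a > 0\<close> elim bound]])
    moreover have "negligible ({0..c} \<inter> {c..})"
      by (rule negligible_subset[of "{c}"]) auto
    ultimately have "(f has_integral F c - F 0 + integral {c..} f) ({0..c} \<union> {c..})"
      by (rule has_integral_Un)
    moreover have "{0..c} \<union> {c..} = {0..}" using elim by auto
    ultimately show ?case by (simp add: integral_unique)
  qed
  then have "((\<lambda>c. integral {c..} f + F c - F 0) \<longlongrightarrow> integral {0..} f) at_top"
    by (intro tendsto_eventually)
  moreover have "((\<lambda>c. integral {c..} f + F c - F 0) \<longlongrightarrow> 0 + 0 - F 0) at_top"
    by (intro tendsto_intros tail lim)
  ultimately show ?thesis
    using tendsto_unique[OF trivial_limit_at_top_linorder] by fastforce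
qed

context strongly_continuous_semigroup begin

section \<open>Finite output energy from a nonnegative solution\<close>

text \<open>Up to time \<open>n\<close> the output energy equals the drop of \<open>P\<close> along
  the trajectory, which is at most \<open>P x x\<close> since \<open>P\<close> is nonnegative.
  Fatou's lemma passes to infinite time.\<close>

lemma lyapunov_equation_energy_le:
  fixes C :: "'a \<Rightarrow>\<^sub>L 'b::real_inner"
  assumes P: "P \<in> pos_sym_ops" and eqn: "lyapunov_equation P (- Q)"
    and Q: "\<And>x. Q x x = (norm (C x))\<^sup>2"
    and x: "x \<in> D"
  shows "energy C x \<le> ennreal (P x x)"
proof -
  let ?g = "\<lambda>t. (norm (C (T t x)))\<^sup>2"
  let ?f = "\<lambda>n t. ennreal (?g t) * indicator {0..real n} t"
  have meas: "?f n \<in> borel_measurable borel" for n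
  proof -
    have "?f n = (\<lambda>t. (ennreal (?g t) * indicator {0..} t) * indicator {0..real n} t)"
      by (auto simp: indicator_def)
    then show ?thesis using energy_measurable[of C x] by simp
  qed
  have "(\<integral>\<^sup>+t. ?f n t \<partial>lborel) \<le> ennreal (P x x)" for n :: nat
  proof -
    let ?h = "\<lambda>t. if t \<in> {0..real n} then ?g t else 0"
    have "((\<lambda>t. (- Q) (T t x) (T t x)) has_integral P (T n x) (T n x) - P x x) {0..real n}"
      by (rule lyapunov_equation_identity[OF eqn x x]) simp
    from has_integral_neg[OF this]
    have "(?g has_integral P x x - P (T n x) (T n x)) {0..real n}"
      by (simp add: blinfun.minus_left Q)
    then have int: "(?h has_integral P x x - P (T n x) (T n x)) UNIV"
      by (simp only: has_integral_restrict_UNIV)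
    \<comment> \<open>Measurability of the real integrand is recovered from its
      \<open>ennreal\<close> version.\<close>
    have "?f n = (\<lambda>t. ennreal (?h t))" by (auto simp: indicator_def)
    with meas[of n] have "(\<lambda>t. enn2real (ennreal (?h t))) \<in> borel_measurable borel" by simp
    then have "?h \<in> borel_measurable borel" by (simp add: if_distrib cong: if_cong)
    then have "(\<integral>\<^sup>+t. ennreal (?h t) \<partial>lborel) = ennreal (P x x - P (T n x) (T n x))"
      using int by (intro nn_integral_has_integral_lborel) auto
    also have "\<dots> \<le> ennreal (P x x)"
      using P by (intro ennreal_leI) (simp add: pos_sym_ops_def)
    finally show ?thesis using \<open>?f n = (\<lambda>t. ennreal (?h t))\<close> by simp
  qed
  note le = this
  have "liminf (\<lambda>n. ?f n t) = ennreal (?g t) * indicator {0..} t" for t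
  proof (intro lim_imp_Liminf tendsto_eventually)
    obtain m :: nat where "t \<le> real m" using real_arch_simple by blast
    then show "\<forall>\<^sub>F n in sequentially. ?f n t = ennreal (?g t) * indicator {0..} t"
      by (intro eventually_sequentiallyI[of m]) (auto simp: indicator_def)
  qed simp
  then have "energy C x = (\<integral>\<^sup>+t. liminf (\<lambda>n. ?f n t) \<partial>lborel)"
    by (simp add: energy_def)
  also have "\<dots> \<le> liminf (\<lambda>n. \<integral>\<^sup>+t. ?f n t \<partial>lborel)"
    using meas by (intro nn_integral_liminf) simp
  also have "\<dots> \<le> ennreal (P x x)"
    using le by (intro Liminf_le) auto
  finally show ?thesis .
qed

text \<open>A general \<open>x\<close> is a limit of domain points \<open>y\<close> with
  \<open>P y y < P x x + 1\<close>. Their energies share one bound, which survives the limit because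
  sublevel sets of the energy are closed.\<close>

lemma lyapunov_equation_energy_finite:
  fixes C :: "'a \<Rightarrow>\<^sub>L 'b::real_inner"
  assumes P: "P \<in> pos_sym_ops" and eqn: "lyapunov_equation P (- Q)"
    and Q: "\<And>x. Q x x = (norm (C x))\<^sup>2"
  shows "energy C x < \<infinity>"
proof -
  let ?U = "{y. P y y < P x x + 1}" and ?E = "{y. energy C y \<le> ennreal (P x x + 1)}"
  have "open ?U"
    by (intro open_Collect_less continuous_intros)
  then have "?U \<inter> closure D \<subseteq> closure (?U \<inter> D)"
    by (rule open_Int_closure_subset)
  moreover have "x \<in> ?U \<inter> closure D"
    unfolding closure_gen_dom by simp
  moreover have "closure (?U \<inter> D) \<subseteq> ?E"
  proof (rule closure_minimal)
    show "?U \<inter> D \<subseteq> ?E"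
      using order_trans[OF lyapunov_equation_energy_le[OF assms] ennreal_leI] by auto
  qed (rule closed_energy_le)
  ultimately have "energy C x \<le> ennreal (P x x + 1)" by blast
  then show ?thesis by (simp add: le_less_trans)
qed

section \<open>The Gramian under exponential decay\<close>

lemma T_form_bound:
  fixes Q :: "'a \<Rightarrow>\<^sub>L 'a dual"
  assumes M: "\<And>t. t \<ge> 0 \<Longrightarrow> norm (T t) \<le> M * exp (- e * t)" and t: "t \<ge> 0"
  shows "\<bar>Q (T t x) (T t y)\<bar> \<le> norm Q * M\<^sup>2 * norm x * norm y * exp (- (2 * e) * t)"
proof -
  have T: "norm (T t x) \<le> M * exp (- e * t) * norm x" for x
    using norm_blinfun[of "T t" x] M[OF t] by (meson mult_right_mono norm_ge_zero order_trans)
  have "\<bar>Q (T t x) (T t y)\<bar> \<le> norm (Q (T t x)) * norm (T t y)"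
    using norm_blinfun[of "Q (T t x)" "T t y"] by simp
  also have "\<dots> \<le> (norm Q * norm (T t x)) * norm (T t y)"
    by (intro mult_right_mono norm_blinfun) auto
  also have "\<dots> \<le> (norm Q * (M * exp (- e * t) * norm x)) * (M * exp (- e * t) * norm y)"
    using order_trans[OF norm_ge_zero T] by (intro mult_mono T order_refl) auto
  also have "\<dots> = norm Q * M\<^sup>2 * norm x * norm y * (exp (- e * t) * exp (- e * t))"
    by (simp add: power2_eq_square)
  also have "exp (- e * t) * exp (- e * t) = exp (- (2 * e) * t)"
    by (simp flip: exp_add)
  finally show ?thesis .
qed

text \<open>Meaningful only when the integrals define a bounded form; otherwise \<open>Blinfun\<close> and
  \<open>prod_right\<close> are arbitrary.\<close>

definition gramian :: "('a \<Rightarrow>\<^sub>L 'a dual) \<Rightarrow> 'a \<Rightarrow>\<^sub>L 'a dual" where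
  "gramian Q = Blinfun (bounded_bilinear.prod_right (\<lambda>x y. integral {0..} (\<lambda>t. Q (T t x) (T t y))))"

context
  fixes M e :: real
  assumes e: "e > 0" and M: "\<And>t. t \<ge> 0 \<Longrightarrow> norm (T t) \<le> M * exp (- e * t)"
begin

lemma integrable_form:
  fixes Q :: "'a \<Rightarrow>\<^sub>L 'a dual"
  shows "(\<lambda>t. Q (T t x) (T t y)) integrable_on {0..}"
  by (rule integrable_on_exp_bound[where a = "2 * e", OF continuous_on_form _ _ T_form_bound[OF M]])
    (use e in auto)

lemma integral_form_bound:
  fixes Q :: "'a \<Rightarrow>\<^sub>L 'a dual"
  shows "\<bar>integral {0..} (\<lambda>t. Q (T t x) (T t y))\<bar> \<le> norm x * norm y * (norm Q * M\<^sup>2 / (2 * e))"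
  using integral_exp_bound[where a = "2 * e" and c = 0,
      OF continuous_on_form _ _ T_form_bound[OF M], of Q x y] e
  by (simp add: mult_ac)

lemma gramian_bounded_bilinear:
  fixes Q :: "'a \<Rightarrow>\<^sub>L 'a dual"
  shows "bounded_bilinear (\<lambda>x y. integral {0..} (\<lambda>t. Q (T t x) (T t y)))"
proof
  show "\<exists>K. \<forall>x y. norm (integral {0..} (\<lambda>t. Q (T t x) (T t y))) \<le> norm x * norm y * K"
    using integral_form_bound[of Q] unfolding real_norm_def by blast
qed (simp_all add: blinfun.add_right blinfun.add_left blinfun.scaleR_right blinfun.scaleR_left
    Henstock_Kurzweil_Integration.integral_add integrable_form)

lemma gramian_apply: "gramian Q x y = integral {0..} (\<lambda>t. Q (T t x) (T t y))"
  unfolding gramian_def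
  using bounded_bilinear.bounded_linear_prod_right[OF gramian_bounded_bilinear]
  by (simp add: bounded_linear_Blinfun_apply bounded_bilinear.prod_right.rep_eq[OF gramian_bounded_bilinear])

lemma norm_gramian_le: "norm (gramian Q) \<le> M\<^sup>2 / (2 * e) * norm Q"
proof (rule norm_blinfun_bound)
  fix x
  show "norm (gramian Q x) \<le> M\<^sup>2 / (2 * e) * norm Q * norm x"
  proof (rule norm_blinfun_bound)
    fix y
    show "norm (gramian Q x y) \<le> M\<^sup>2 / (2 * e) * norm Q * norm x * norm y"
      using integral_form_bound[of Q x y] by (simp add: gramian_apply mult_ac)
  qed (use e in simp)
qed (use e in simp)

lemma gramian_sym: "Q \<in> sym_ops \<Longrightarrow> gramian Q \<in> sym_ops"
  by (simp add: sym_ops_iff gramian_apply)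

lemma gramian_pos: "Q \<in> pos_sym_ops \<Longrightarrow> gramian Q \<in> pos_sym_ops"
  by (auto simp: pos_sym_ops_def gramian_sym gramian_apply intro!: integral_nonneg integrable_form)

lemma form_tendsto_0:
  fixes Q :: "'a \<Rightarrow>\<^sub>L 'a dual"
  shows "((\<lambda>t. Q (T t x) (T t y)) \<longlongrightarrow> 0) at_top"
proof -
  let ?K = "norm Q * M\<^sup>2 * norm x * norm y"
  have "((\<lambda>t. exp (- (2 * e) * t)) \<longlongrightarrow> 0) at_top"
    using e by (intro filterlim_compose[OF exp_at_bot]
        filterlim_tendsto_neg_mult_at_bot[OF tendsto_const] filterlim_ident) auto
  from tendsto_mult_left[OF this, of ?K]
  have "((\<lambda>t. ?K * exp (- (2 * e) * t)) \<longlongrightarrow> 0) at_top" by simp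
  moreover have "\<forall>\<^sub>F t in at_top. norm (Q (T t x) (T t y)) \<le> ?K * exp (- (2 * e) * t)"
    using eventually_ge_at_top[of 0]
    by eventually_elim (use T_form_bound[OF M] in auto)
  ultimately show ?thesis by (rule Lim_null_comparison[rotated])
qed

text \<open>The integrand is the derivative of \<open>Q (T t x) (T t y)\<close>, which vanishes at
  infinity and equals \<open>Q x y\<close> at time 0.\<close>

lemma lyapunov_equation_gramian: "lyapunov_equation (gramian Q) (- Q)"
  unfolding lyapunov_equation_def
proof (intro ballI)
  fix x y assume xy: "x \<in> D" "y \<in> D"
  let ?f = "\<lambda>t. Q (T t (A x)) (T t y) + Q (T t x) (T t (A y))"
  let ?K = "norm Q * M\<^sup>2 * norm (A x) * norm y + norm Q * M\<^sup>2 * norm x * norm (A y)"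
  have "integral {0..} ?f = - Q (T 0 x) (T 0 y)"
  proof (rule integral_half_line_FTC[where F = "\<lambda>t. Q (T t x) (T t y)"])
    show "continuous_on {0..} ?f"
      by (intro continuous_intros T_continuous)
    fix t :: real assume t: "t \<ge> 0"
    show "\<bar>?f t\<bar> \<le> ?K * exp (- (2 * e) * t)"
      unfolding distrib_right
      by (intro order_trans[OF abs_triangle_ineq] add_mono T_form_bound M t)
    show "((\<lambda>t. Q (T t x) (T t y)) has_vector_derivative ?f t) (at t within {0..})"
      using xy t by (rule form_has_vector_derivative)
  qed (use e form_tendsto_0 in auto)
  then show "gramian Q (A x) y + gramian Q x (A y) = (- Q) x y"
    by (simp add: gramian_apply Henstock_Kurzweil_Integration.integral_add integrable_form
        blinfun.minus_left)
qed

section \<open>Inverting the Lyapunov generator\<close>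

text \<open>Along trajectories the form is constant and also tends to 0.\<close>

lemma lyapunov_equation_0_unique:
  assumes "lyapunov_equation P 0"
  shows "P = 0"
proof (rule form_eq_on_gen_dom)
  fix x y assume xy: "x \<in> D" "y \<in> D"
  have const: "P (T t x) (T t y) = P x y" if "t \<ge> 0" for t
    using lyapunov_equation_identity[OF assms xy that]
    by (auto dest: has_integral_unique[OF has_integral_0])
  have "\<forall>\<^sub>F t in at_top. P (T t x) (T t y) = P x y"
    using eventually_ge_at_top[of "0::real"] by eventually_elim (rule const)
  then have "((\<lambda>t. P (T t x) (T t y)) \<longlongrightarrow> P x y) at_top"
    by (rule tendsto_eventually)
  with form_tendsto_0[of P x y] show "P x y = (0 :: 'a \<Rightarrow>\<^sub>L 'a dual) x y"
    using tendsto_unique[OF trivial_limit_at_top_linorder] by fastforce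
qed

lemma lyapunov_gen_inj: "inj_on (lyapunov_gen T) (lyapunov_dom T)"
proof (rule inj_onI)
  fix P P' assume *: "P \<in> lyapunov_dom T" "P' \<in> lyapunov_dom T" "lyapunov_gen T P = lyapunov_gen T P'"
  then have "lyapunov_equation P (lyapunov_gen T P)" "lyapunov_equation P' (lyapunov_gen T P)"
    using lyapunov_dom_iff by metis+
  then have "lyapunov_equation (P - P') 0"
    using lyapunov_equation_diff by fastforce
  then have "P - P' = 0"
    by (rule lyapunov_equation_0_unique)
  then show "P = P'" by simp
qed

lemma lyapunov_gen_gramian:
  assumes "Q \<in> sym_ops"
  shows "- gramian Q \<in> lyapunov_dom T" "lyapunov_gen T (- gramian Q) = Q"
proof -
  have "- gramian Q \<in> sym_ops"
    using gramian_sym[OF assms] by (simp add: sym_ops_iff blinfun.minus_left)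
  moreover have "lyapunov_equation (- gramian Q) Q"
    using lyapunov_equation_minus[OF lyapunov_equation_gramian[of Q]] by simp
  ultimately show "- gramian Q \<in> lyapunov_dom T" "lyapunov_gen T (- gramian Q) = Q"
    using lyapunov_dom_iff by blast+
qed

lemma lyapunov_inv_eq: "Q \<in> sym_ops \<Longrightarrow> lyapunov_inv T Q = - gramian Q"
  using inv_into_f_f[OF lyapunov_gen_inj] lyapunov_gen_gramian by metis

text \<open>Uniqueness gives injectivity, the negative Gramian gives preimages, and its norm
  estimate bounds the inverse.\<close>

lemma lyapunov_gen_invertible: "has_bounded_inverse_on sym_ops (lyapunov_dom T) (lyapunov_gen T)"
  unfolding has_bounded_inverse_on_def bij_betw_def
proof (intro conjI)
  show "lyapunov_gen T ` lyapunov_dom T = sym_ops"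
  proof
    show "lyapunov_gen T ` lyapunov_dom T \<subseteq> sym_ops"
      using lyapunov_equation_sym lyapunov_dom_iff by blast
    show "sym_ops \<subseteq> lyapunov_gen T ` lyapunov_dom T"
      using lyapunov_gen_gramian by (metis image_eqI subsetI)
  qed
  show "\<exists>K. \<forall>Q\<in>sym_ops. norm (lyapunov_inv T Q) \<le> K * norm Q"
    using norm_gramian_le by (intro exI[of _ "M\<^sup>2 / (2 * e)"]) (simp add: lyapunov_inv_eq)
qed (rule lyapunov_gen_inj)

end

end

section \<open>The three equivalent conditions\<close>

lemma observation_form: "(hilbert_adjoint C o\<^sub>L C) x y = C x \<bullet> C y"
  by (simp add: hilbert_adjoint_apply)

lemma observation_form_pos: "hilbert_adjoint C o\<^sub>L C \<in> pos_sym_ops"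
  unfolding pos_sym_ops_def sym_ops_iff mem_Collect_eq observation_form by (simp add: inner_commute)

theorem theorem6:
  fixes T :: "real \<Rightarrow> 'x::banach \<Rightarrow>\<^sub>L 'x"
    and C :: "'x \<Rightarrow>\<^sub>L 'n::{real_inner, complete_space}"
  assumes "reflexive_space TYPE('x)"
    and "C0_semigroup T"
    and "detectable_L2 C T"
  shows "((\<exists>P \<in> pos_sym_ops.
            blinfun_apply P ` gen_dom T \<subseteq> gen_adj_dom T \<and>
            norm_on (gen_dom T) (lyapunov_expr T P) < \<infinity> \<and>
            bounded_extension (gen_dom T) (lyapunov_expr T P) = - (hilbert_adjoint C o\<^sub>L C))
          \<longleftrightarrow> exponentially_stable T)
    \<and> (exponentially_stable T
          \<longleftrightarrow> has_bounded_inverse_on sym_ops (lyapunov_dom T) (lyapunov_gen T)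
              \<and> (\<forall>P \<in> pos_sym_ops. - lyapunov_inv T P \<in> pos_sym_ops))"
    (is "(?i \<longleftrightarrow> ?ii) \<and> (?ii \<longleftrightarrow> ?iii)")
proof -
  interpret strongly_continuous_semigroup T by unfold_locales (rule assms(2))
  let ?Q = "hilbert_adjoint C o\<^sub>L C"
  have i_iff: "?i \<longleftrightarrow> (\<exists>P\<in>pos_sym_ops. lyapunov_equation P (- ?Q))"
    using lyapunov_equationI lyapunov_equation_imp_dom lyapunov_equation_imp_norm_on
      lyapunov_equation_imp_extension
    by metis
  have i_ii: ?ii if ?i
  proof -
    from that i_iff obtain P where P: "P \<in> pos_sym_ops" "lyapunov_equation P (- ?Q)" by blast
    have "energy C x < \<infinity>" for x
      by (rule lyapunov_equation_energy_finite[OF P]) (simp only: observation_form power2_norm_eq_inner)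
    \<comment> \<open>Detectability carries square integrability from the output to the
      trajectory.\<close>
    then have "energy id_blinfun x < \<infinity>" for x
      using assms(3) by (simp add: detectable_L2_def energy_def)
    then show ?ii by (rule Datko)
  qed
  have ii_iii: ?iii if ?ii
  proof -
    from that obtain M e where Me: "e > 0" "\<And>t. t \<ge> 0 \<Longrightarrow> norm (T t) \<le> M * exp (- e * t)"
      unfolding exponentially_stable_def by blast
    show ?iii
      using lyapunov_gen_invertible[OF Me] gramian_pos[OF Me] lyapunov_inv_eq[OF Me]
      by (auto simp: pos_sym_ops_def)
  qed
  have iii_i: ?i if ?iii
  proof -
    \<comment> \<open>The required solution is \<open>- ?P\<close>: the negation makes it
      nonnegative by (iii) and turns the right-hand side into \<open>- ?Q\<close>.\<close>
    let ?P = "lyapunov_inv T ?Q"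
    have "?Q \<in> lyapunov_gen T ` lyapunov_dom T"
      using that observation_form_pos[of C]
      by (auto simp: has_bounded_inverse_on_def bij_betw_def pos_sym_ops_def)
    then have "?P \<in> lyapunov_dom T" "lyapunov_gen T ?P = ?Q"
      by (auto intro: inv_into_into f_inv_into_f)
    then have "lyapunov_equation (- ?P) (- ?Q)"
      using lyapunov_dom_iff by (blast intro: lyapunov_equation_minus)
    moreover have "- ?P \<in> pos_sym_ops"
      using that observation_form_pos by blast
    ultimately show ?i using i_iff by blast
  qed
  show ?thesis using i_ii ii_iii iii_i by blast
qed

end
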